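(* Let $n\ge 2$, $L\ge 1$ be integers and let $c>0$ be real. Let $\Phi_1,\dots,\Phi_L$ be the clauses of a YES instance of Restricted Quantum 2-SAT on $n$ qubits with promise gap $c$. Put $$f=\max\left\{\frac{7}{c},1\right\},\qquad T=\frac{f^2L^2n^2}{2},\qquad N=T\left(\frac{fL-1}{fL}\right)^3-fLn,$$ and assume that $T$ is an integer. If the Quantum Algorithm is run on these clauses for $T$ steps, then with probability at least $2/3$ at least $N$ of the $T$ measurement outcomes have value $0$.
   Context: Setting. There are $n$ qubits. For each qubit $i$ fix an orthonormal basis $\{|0\rangle_i,|1\rangle_i\}$ of its space $\mathbb{C}^2$ (this basis may depend on $i$ and need not be known to the algorithm). Quantum 2-SAT. A clause is a rank-one orthogonal projector $\Phi_\alpha=|\phi_\alpha\rangle\langle\phi_\alpha|$ ($|\phi_\alpha\rangle$ a unit vector in the space of two distinct qubits $i,j$ depending on $\alpha$), acting as the identity on all other qubits. Put $H=\sum_{\alpha=1}^L\Phi_\alpha$. In a YES instance there is an $n$-qubit density operator $\rho$ with $\mathrm{tr}[H\rho]=0$; in a NO instance $\mathrm{tr}[H\rho]\ge c$ for every $n$-qubit density operator $\rho$. The number $c>0$ is the promise gap. YES instance of Restricted Quantum 2-SAT. The single-qubit bases can be chosen so that every clause has the form $\Phi_\alpha=|\phi_\alpha\rangle\langle\phi_\alpha|$ with $|\phi_\alpha\rangle=a_\alpha|01\rangle_{i,j}+b_\alpha|10\rangle_{i,j}$, $a_\alpha,b_\alpha\in\mathbb{C}$, $|a_\alpha|^2+|b_\alpha|^2=1$.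 (Then $|0\rangle^{\otimes n}$ is annihilated by all clauses.) Quantum Algorithm, run for $T$ steps. The initial state is the maximally mixed state $\mathbb{1}/2^n$. At each step, choose $\alpha\in\{1,\dots,L\}$ uniformly at random (independently of the past) and perform the projective measurement $\{\Phi_\alpha,\mathbb{1}-\Phi_\alpha\}$ on the current state $\rho$. Outcome $1$ occurs with probability $\mathrm{tr}[\Phi_\alpha\rho]$, and the post-measurement state is $\Phi_\alpha\rho\Phi_\alpha/\mathrm{tr}[\Phi_\alpha\rho]$; then one of the two qubits in the support of $\Phi_\alpha$ is chosen uniformly at random and a Haar-random unitary is applied to it (on average, applying to qubit $i$ the map $\Lambda_i(\rho)=\frac{\mathbb{1}_i}{2}\otimes\mathrm{tr}_i[\rho]$). Outcome $0$ occurs with probability $1-\mathrm{tr}[\Phi_\alpha\rho]$, and the state becomes $(\mathbb{1}-\Phi_\alpha)\rho(\mathbb{1}-\Phi_\alpha)/(1-\mathrm{tr}[\Phi_\alpha\rho])$. Each step thus yields one measurement outcome in $\{0,1\}$. *)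

theory Defs
  imports "HOL-Probability.Probability"
begin

text \<open>
  The qubits are indexed by a finite type \<open>'q\<close>, so that the number of qubits is \<open>CARD('q)\<close>. The basis labels
  0 and 1 are \<open>False\<close> and \<open>True\<close>. All matrices are written in one fixed reference basis, the one used
  to identify each qubit with the space \<open>complex ^ bool\<close>.
\<close>

type_synonym 'q operator = "complex ^ ('q \<Rightarrow> bool) ^ ('q \<Rightarrow> bool)"

text \<open>
  \<open>(i, j, \<phi>)\<close> stands for the vector \<open>\<phi>\<close> in the space of the two qubits \<open>i\<close> and \<open>j\<close>, with
  \<open>\<phi> $ (s, t)\<close> the coefficient of \<open>s\<close> at \<open>i\<close> and \<open>t\<close> at \<open>j\<close>.
\<close>

type_synonym 'q clause = "'q \<times> 'q \<times> (complex ^ (bool \<times> bool))"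

definition hermitian_adjoint :: "complex ^ 'n ^ 'm \<Rightarrow> complex ^ 'm ^ 'n" where
  "hermitian_adjoint A = (\<chi> x y. cnj (A $ y $ x))"

definition unitary :: "complex ^ 'n ^ 'n \<Rightarrow> bool" where
  "unitary U \<longleftrightarrow> hermitian_adjoint U ** U = mat 1 \<and> U ** hermitian_adjoint U = mat 1"

definition haar_measure_U2 :: "(complex ^ bool ^ bool) measure \<Rightarrow> bool" where
  "haar_measure_U2 \<mu> \<longleftrightarrow>
     prob_space \<mu> \<and> sets \<mu> = sets borel \<and> (AE U in \<mu>. unitary U) \<and>
     (\<forall>V. unitary V \<longrightarrow> distr \<mu> borel (\<lambda>U. V ** U) = \<mu>)"

definition on_qubit :: "'q::finite \<Rightarrow> complex ^ bool ^ bool \<Rightarrow> 'q operator" where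
  "on_qubit i U = (\<chi> x y. if \<forall>k. k \<noteq> i \<longrightarrow> x k = y k then U $ x i $ y i else 0)"

fun projector :: "'q::finite clause \<Rightarrow> 'q operator" where
  "projector (i, j, \<phi>) =
     (\<chi> x y. if \<forall>k. k \<noteq> i \<and> k \<noteq> j \<longrightarrow> x k = y k
            then \<phi> $ (x i, x j) * cnj (\<phi> $ (y i, y j)) else 0)"

fun qubits :: "'q clause \<Rightarrow> 'q set" where
  "qubits (i, j, \<phi>) = {i, j}"

fun valid_clause :: "'q clause \<Rightarrow> bool" where
  "valid_clause (i, j, \<phi>) \<longleftrightarrow> i \<noteq> j \<and> norm \<phi> = 1"

definition orthonormal_basis :: "(bool \<Rightarrow> complex ^ bool) \<Rightarrow> bool" where
  "orthonormal_basis e \<longleftrightarrow>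
     (\<forall>s t. (\<Sum>k\<in>UNIV. cnj (e s $ k) * e t $ k) = (if s = t then 1 else 0))"

definition tensor :: "complex ^ bool \<Rightarrow> complex ^ bool \<Rightarrow> complex ^ (bool \<times> bool)" where
  "tensor u v = (\<chi> p. u $ fst p * v $ snd p)"

fun restricted_clause :: "('q \<Rightarrow> bool \<Rightarrow> complex ^ bool) \<Rightarrow> 'q clause \<Rightarrow> bool" where
  "restricted_clause e (i, j, \<phi>) \<longleftrightarrow>
     (\<exists>a b. \<phi> = a *s tensor (e i False) (e j True) + b *s tensor (e i True) (e j False) \<and>
            (cmod a)\<^sup>2 + (cmod b)\<^sup>2 = 1)"

definition restricted_yes_instance :: "nat \<Rightarrow> (nat \<Rightarrow> 'q clause) \<Rightarrow> bool" where
  "restricted_yes_instance L C \<longleftrightarrow>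
     (\<forall>\<alpha>\<in>{1..L}. valid_clause (C \<alpha>)) \<and>
     (\<exists>e. (\<forall>i. orthonormal_basis (e i)) \<and> (\<forall>\<alpha>\<in>{1..L}. restricted_clause e (C \<alpha>)))"

definition outcome1_prob :: "'q::finite clause \<Rightarrow> 'q operator \<Rightarrow> real" where
  "outcome1_prob \<Phi> \<rho> = Re (trace (projector \<Phi> ** \<rho>))"

definition post1 :: "'q::finite clause \<Rightarrow> 'q operator \<Rightarrow> 'q operator" where
  "post1 \<Phi> \<rho> = (projector \<Phi> ** \<rho> ** projector \<Phi>) /\<^sub>R outcome1_prob \<Phi> \<rho>"

definition post0 :: "'q::finite clause \<Rightarrow> 'q operator \<Rightarrow> 'q operator" where
  "post0 \<Phi> \<rho> = ((mat 1 - projector \<Phi>) ** \<rho> ** (mat 1 - projector \<Phi>)) /\<^sub>R (1 - outcome1_prob \<Phi> \<rho>)"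

definition rotate_qubit :: "'q::finite \<Rightarrow> complex ^ bool ^ bool \<Rightarrow> 'q operator \<Rightarrow> 'q operator" where
  "rotate_qubit i U \<rho> = on_qubit i U ** \<rho> ** hermitian_adjoint (on_qubit i U)"

abbreviation step_space :: "(bool \<times> 'q::finite operator) measure" where
  "step_space \<equiv> count_space UNIV \<Otimes>\<^sub>M borel"

text \<open>
  The joint law of the measurement outcome and the new state in one step from \<open>\<rho>\<close>. The measure \<open>\<mu>\<close> is
  the law of the random single-qubit unitary.
\<close>

definition algorithm_step ::
  "(complex ^ bool ^ bool) measure \<Rightarrow> nat \<Rightarrow> (nat \<Rightarrow> 'q::finite clause) \<Rightarrow> 'q operator \<Rightarrow>
   (bool \<times> 'q operator) measure" where
  "algorithm_step \<mu> L C \<rho> =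
     measure_pmf (pmf_of_set {1..L}) \<bind> (\<lambda>\<alpha>.
     measure_pmf (bernoulli_pmf (outcome1_prob (C \<alpha>) \<rho>)) \<bind> (\<lambda>x.
       if x then
         measure_pmf (pmf_of_set (qubits (C \<alpha>))) \<bind> (\<lambda>i.
         \<mu> \<bind> (\<lambda>U. return step_space (True, rotate_qubit i U (post1 (C \<alpha>) \<rho>))))
       else return step_space (False, post0 (C \<alpha>) \<rho>)))"

text \<open>The law of the list of outcomes of \<open>T\<close> steps started in the state \<open>\<rho>\<close>.\<close>

primrec outcomes_from ::
  "(complex ^ bool ^ bool) measure \<Rightarrow> nat \<Rightarrow> (nat \<Rightarrow> 'q::finite clause) \<Rightarrow> nat \<Rightarrow> 'q operator \<Rightarrow>
   bool list measure" where
  "outcomes_from \<mu> L C 0 \<rho> = return (count_space UNIV) []"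
| "outcomes_from \<mu> L C (Suc T) \<rho> =
     algorithm_step \<mu> L C \<rho> \<bind> (\<lambda>(x, \<rho>').
     outcomes_from \<mu> L C T \<rho>' \<bind> (\<lambda>xs.
     return (count_space UNIV) (x # xs)))"

definition maximally_mixed :: "'q::finite operator" where
  "maximally_mixed = mat 1 /\<^sub>R 2 ^ CARD('q)"

definition algorithm_outcomes ::
  "(complex ^ bool ^ bool) measure \<Rightarrow> nat \<Rightarrow> (nat \<Rightarrow> 'q::finite clause) \<Rightarrow> nat \<Rightarrow> bool list measure" where
  "algorithm_outcomes \<mu> L C T = outcomes_from \<mu> L C T maximally_mixed"

end

theory Submission
  imports Defs
begin

text \<open>
  Let \<open>Z\<^sub>k\<close> be the Pauli operator of qubit \<open>k\<close> in its hidden basis and \<open>M = \<Sum>\<^sub>k Z\<^sub>k\<close>. The range of a restricted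
  clause on \<open>i, j\<close> is killed by \<open>Z\<^sub>i + Z\<^sub>j\<close>, so the clause commutes with \<open>M\<close>, and one step of the algorithm
  decreases the expectation of the positive operator \<open>(n\<^sup>2 - M\<^sup>2) / 2\<close> by exactly the probability of outcome
  1. Hence the expected number of outcomes 1 is at most \<open>n\<^sup>2 / 2\<close>, whatever \<open>T\<close> is. For \<open>f L \<ge> 2\<close> we have
  \<open>T - N \<ge> 3 n\<^sup>2 / 2\<close>, and Markov's inequality gives the bound. The remaining case has \<open>L = 1\<close>: there the
  first outcome is 0 with probability 3/4, and then all outcomes are 0.
\<close>

subsection \<open>Matrices and states\<close>

text \<open>Why the potential falls by exactly the probability of outcome 1: let \<open>R\<close> be
  the sum of the \<open>Z_k\<close> with k different from i, j. On the range of the clause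
  \<open>M = R\<close>. Replacing qubit i by the maximally mixed state turns \<open>M^2\<close> into
  \<open>(M - Z_i)^2 + 1\<close>, which there is \<open>R^2 + 2 R Z_j + 2\<close>. The middle term
  has no definite sign, but the random choice between i and j averages it with
  \<open>2 R Z_i\<close>, and \<open>Z_i + Z_j = 0\<close>. So \<open>M^2\<close> rises by 2 on
  average, hence the factor 1/2 in the potential. The measurement itself costs nothing on average,
  as the clause commutes with \<open>M^2\<close>. Markov's inequality asks for \<open>T - N\<close>
  to be three times the bound \<open>n^2 / 2\<close>. If \<open>f L\<close> is only slightly above
  1, then \<open>T - N\<close> is about \<open>n^2 / 2 + n\<close>, which is too small; this is why
  a single clause needs its own argument. A measurement outcome of probability 0 has the zero matrix
  as its normalised state. The potential is therefore kept linear in the operator, and the one-step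
  estimates are weighted by the outcome probabilities.\<close>

lemma matrix_distribs:
  fixes A B :: "complex ^ 'n ^ 'm" and D E :: "complex ^ 'k ^ 'n"
  shows "(A + B) ** D = A ** D + B ** D" "A ** (D + E) = A ** D + A ** E"
    "(A - B) ** D = A ** D - B ** D" "A ** (D - E) = A ** D - A ** E"
    "(- A) ** D = - (A ** D)" "A ** (- D) = - (A ** D)"
    "(r *\<^sub>R A) ** D = r *\<^sub>R (A ** D)" "A ** (r *\<^sub>R D) = r *\<^sub>R (A ** D)"
    "A ** 0 = (0 :: complex ^ 'k ^ 'm)" "(0 :: complex ^ 'n ^ 'm) ** D = 0"
  by (simp_all add: vec_eq_iff matrix_matrix_mult_def sum.distrib sum_subtractf algebra_simps
      sum_negf scaleR_sum_right)

lemma matrix_sum_distribs: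
  fixes A :: "'i \<Rightarrow> complex ^ 'n ^ 'm" and B :: "complex ^ 'k ^ 'n" and D :: "complex ^ 'm ^ 'k"
  shows "(\<Sum>i\<in>I. A i) ** B = (\<Sum>i\<in>I. A i ** B)" "D ** (\<Sum>i\<in>I. A i) = (\<Sum>i\<in>I. D ** A i)"
  by (induction I rule: infinite_finite_induct) (auto simp: matrix_distribs)

lemma adjoint_simps [simp]:
  fixes A B :: "complex ^ 'n ^ 'm"
  shows "hermitian_adjoint (hermitian_adjoint A) = A"
    "hermitian_adjoint (A + B) = hermitian_adjoint A + hermitian_adjoint B"
    "hermitian_adjoint (A - B) = hermitian_adjoint A - hermitian_adjoint B"
    "hermitian_adjoint (r *\<^sub>R A) = r *\<^sub>R hermitian_adjoint A"
    "hermitian_adjoint (0 :: complex ^ 'n ^ 'm) = 0"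
    "hermitian_adjoint (mat 1 :: complex ^ 'n ^ 'n) = mat 1"
  by (simp_all add: hermitian_adjoint_def vec_eq_iff mat_def)

lemma adjoint_mult [simp]:
  "hermitian_adjoint (A ** B) = hermitian_adjoint B ** hermitian_adjoint A"
  by (simp add: hermitian_adjoint_def vec_eq_iff matrix_matrix_mult_def mult.commute)

lemma adjoint_sum [simp]: "hermitian_adjoint (\<Sum>i\<in>I. A i) = (\<Sum>i\<in>I. hermitian_adjoint (A i))"
  by (induction I rule: infinite_finite_induct) auto

abbreviation re_trace :: "complex ^ 'n ^ 'n \<Rightarrow> real" where
  "re_trace A \<equiv> Re (trace A)"

lemma re_trace_simps:
  "re_trace (A + B) = re_trace A + re_trace B" "re_trace (A - B) = re_trace A - re_trace B"
  "re_trace (- A) = - re_trace A" "re_trace (r *\<^sub>R A) = r * re_trace A"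
  "re_trace (0 :: complex ^ 'n ^ 'n) = 0"
  by (simp_all add: trace_def sum.distrib sum_subtractf sum_negf sum_distrib_left)

lemma re_trace_sum: "re_trace (\<Sum>i\<in>I. A i) = (\<Sum>i\<in>I. re_trace (A i))"
  by (induction I rule: infinite_finite_induct) (auto simp: re_trace_simps)

lemma re_trace_adjoint_mult_nonneg: "0 \<le> re_trace (A ** hermitian_adjoint A)"
proof -
  have "re_trace (A ** hermitian_adjoint A) = (\<Sum>x\<in>UNIV. \<Sum>y\<in>UNIV. (cmod (A $ x $ y))\<^sup>2)"
    by (simp add: trace_def matrix_matrix_mult_def hermitian_adjoint_def complex_norm_square[symmetric]
        del: of_real_power)
  then show ?thesis by (simp add: sum_nonneg)
qed

text \<open>Positive semidefiniteness as a factorisation: closure under conjugation and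
  nonnegativity of the trace become immediate, without spectral theory.\<close>

definition positive_matrix :: "complex ^ 'n ^ 'n \<Rightarrow> bool" where
  "positive_matrix \<rho> \<longleftrightarrow> (\<exists>A :: complex ^ 'n ^ 'n. \<rho> = A ** hermitian_adjoint A)"

definition density_matrix :: "complex ^ 'n ^ 'n \<Rightarrow> bool" where
  "density_matrix \<rho> \<longleftrightarrow> positive_matrix \<rho> \<and> re_trace \<rho> = 1"

lemma positive_matrix_conj:
  fixes \<rho> B :: "complex ^ 'a ^ 'a"
  shows "positive_matrix \<rho> \<Longrightarrow> positive_matrix (B ** \<rho> ** hermitian_adjoint B)"
proof -
  assume "positive_matrix \<rho>"
  then obtain A :: "complex ^ 'a ^ 'a" where "\<rho> = A ** hermitian_adjoint A"
    unfolding positive_matrix_def by blast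
  then have "B ** \<rho> ** hermitian_adjoint B = (B ** A) ** hermitian_adjoint (B ** A)"
    by (simp add: matrix_mul_assoc)
  then show ?thesis unfolding positive_matrix_def by blast
qed

lemma positive_matrix_scaleR:
  fixes \<rho> :: "complex ^ 'a ^ 'a"
  assumes "positive_matrix \<rho>" "0 \<le> r"
  shows "positive_matrix (r *\<^sub>R \<rho>)"
proof -
  from assms obtain A :: "complex ^ 'a ^ 'a" where "\<rho> = A ** hermitian_adjoint A" unfolding positive_matrix_def by blast
  then have "r *\<^sub>R \<rho> = (sqrt r *\<^sub>R A) ** hermitian_adjoint (sqrt r *\<^sub>R A)"
    using assms by (simp add: matrix_distribs)
  then show ?thesis unfolding positive_matrix_def by blast
qed

lemma positive_matrix_re_trace: "positive_matrix \<rho> \<Longrightarrow> 0 \<le> re_trace \<rho>"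
  by (auto simp: positive_matrix_def re_trace_adjoint_mult_nonneg)

lemma positive_matrix_re_trace_mult:
  fixes \<rho> B :: "complex ^ 'a ^ 'a"
  assumes "positive_matrix \<rho>"
  shows "0 \<le> re_trace (hermitian_adjoint B ** B ** \<rho>)"
proof -
  have "trace (hermitian_adjoint B ** B ** \<rho>) = trace (B ** \<rho> ** hermitian_adjoint B)"
    by (metis matrix_mul_assoc trace_mul_sym)
  then show ?thesis using positive_matrix_re_trace[OF positive_matrix_conj[OF assms]] by metis
qed

lemma density_matrix_conj:
  fixes \<rho> U :: "complex ^ 'a ^ 'a"
  assumes "density_matrix \<rho>" "hermitian_adjoint U ** U = mat 1"
  shows "density_matrix (U ** \<rho> ** hermitian_adjoint U)"
proof -
  have "trace (U ** \<rho> ** hermitian_adjoint U) = trace (hermitian_adjoint U ** U ** \<rho>)"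
    by (metis matrix_mul_assoc trace_mul_sym)
  then show ?thesis using assms by (simp add: density_matrix_def positive_matrix_conj)
qed

lemma density_matrix_maximally_mixed: "density_matrix (maximally_mixed :: 'q::finite operator)"
proof -
  have "positive_matrix (mat 1 :: 'q operator)"
    unfolding positive_matrix_def by (rule exI[of _ "mat 1"]) simp
  then show ?thesis
    by (simp add: density_matrix_def maximally_mixed_def positive_matrix_scaleR re_trace_simps trace_I
        card_fun of_nat_power)
qed

subsection \<open>Local operators\<close>

text \<open>In a product with a one-qubit operator the inner index may differ from the outer one
  only at \<open>i\<close>, so a sum over all bit strings collapses to two terms.\<close>

lemma sum_agree_off1:
  fixes x :: "'q::finite \<Rightarrow> bool" and f :: "_ \<Rightarrow> 'b::comm_monoid_add"
  shows "(\<Sum>z\<in>UNIV. if \<forall>k. k \<noteq> i \<longrightarrow> x k = z k then f z else 0) = (\<Sum>s\<in>UNIV. f (x(i := s)))"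
proof -
  have eq: "{z. \<forall>k. k \<noteq> i \<longrightarrow> x k = z k} = range (\<lambda>s. x(i := s))"
  proof (safe, goal_cases)
    case (1 z)
    then have "z = x(i := z i)" by (simp add: fun_eq_iff)
    then show ?case by blast
  qed auto
  have "inj (\<lambda>s. x(i := s))" by (metis fun_upd_same injI)
  then have "(\<Sum>s\<in>UNIV. f (x(i := s))) = sum f {z. \<forall>k. k \<noteq> i \<longrightarrow> x k = z k}"
    by (simp add: eq sum.reindex)
  also have "\<dots> = (\<Sum>z\<in>UNIV. if \<forall>k. k \<noteq> i \<longrightarrow> x k = z k then f z else 0)"
    by (subst sum.inter_filter[symmetric]) auto
  finally show ?thesis ..
qed

lemma sum_agree_off2:
  fixes x :: "'q::finite \<Rightarrow> bool" and f :: "_ \<Rightarrow> 'b::comm_monoid_add"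
  assumes "i \<noteq> j"
  shows "(\<Sum>z\<in>UNIV. if \<forall>k. k \<noteq> i \<and> k \<noteq> j \<longrightarrow> x k = z k then f z else 0) =
    (\<Sum>p\<in>UNIV. f (x(i := fst p, j := snd p)))"
proof -
  have eq: "{z. \<forall>k. k \<noteq> i \<and> k \<noteq> j \<longrightarrow> x k = z k} = range (\<lambda>p. x(i := fst p, j := snd p))"
  proof (safe, goal_cases)
    case (1 z)
    then have "z = x(i := fst (z i, z j), j := snd (z i, z j))" by (simp add: fun_eq_iff)
    then show ?case by blast
  qed auto
  have "inj (\<lambda>p. x(i := fst p, j := snd p))"
    by (rule injI) (metis assms fun_upd_apply prod_eqI)
  then have "(\<Sum>p\<in>UNIV. f (x(i := fst p, j := snd p))) =
      sum f {z. \<forall>k. k \<noteq> i \<and> k \<noteq> j \<longrightarrow> x k = z k}"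
    by (simp add: eq sum.reindex)
  also have "\<dots> = (\<Sum>z\<in>UNIV. if \<forall>k. k \<noteq> i \<and> k \<noteq> j \<longrightarrow> x k = z k then f z else 0)"
    by (subst sum.inter_filter[symmetric]) auto
  finally show ?thesis ..
qed

lemma on_qubit_mult_nth:
  "(on_qubit i U ** A) $ x $ y = (\<Sum>s\<in>UNIV. U $ x i $ s * A $ (x(i := s)) $ y)"
proof -
  have "(on_qubit i U ** A) $ x $ y =
      (\<Sum>z\<in>UNIV. if \<forall>k. k \<noteq> i \<longrightarrow> x k = z k then U $ x i $ z i * A $ z $ y else 0)"
    by (auto simp: matrix_matrix_mult_def on_qubit_def intro!: sum.cong)
  then show ?thesis by (simp only: sum_agree_off1) simp
qed

lemma mult_on_qubit_nth:
  "(A ** on_qubit i U) $ x $ y = (\<Sum>s\<in>UNIV. A $ x $ (y(i := s)) * U $ s $ y i)"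
proof -
  have "(A ** on_qubit i U) $ x $ y =
      (\<Sum>z\<in>UNIV. if \<forall>k. k \<noteq> i \<longrightarrow> y k = z k then A $ x $ z * U $ z i $ y i else 0)"
    by (auto simp: matrix_matrix_mult_def on_qubit_def intro!: sum.cong)
  then show ?thesis by (simp only: sum_agree_off1) simp
qed

lemma on_qubit_mult: "on_qubit i U ** on_qubit i V = on_qubit i (U ** V)"
proof -
  have "(on_qubit i U ** on_qubit i V) $ x $ y = on_qubit i (U ** V) $ x $ y" for x y
  proof (cases "\<forall>k. k \<noteq> i \<longrightarrow> x k = y k")
    case True
    then show ?thesis by (simp add: on_qubit_mult_nth) (simp add: on_qubit_def matrix_matrix_mult_def)
  next
    case False
    then have "on_qubit i V $ (x(i := s)) $ y = 0" for s by (auto simp: on_qubit_def)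
    with False show ?thesis by (subst on_qubit_mult_nth) (auto simp: on_qubit_def)
  qed
  then show ?thesis by (simp add: vec_eq_iff)
qed

lemma on_qubit_adjoint [simp]: "hermitian_adjoint (on_qubit i U) = on_qubit i (hermitian_adjoint U)"
  by (auto simp: on_qubit_def hermitian_adjoint_def vec_eq_iff)

lemma on_qubit_one [simp]: "on_qubit i (mat 1) = mat 1"
proof -
  have "(\<forall>k. k \<noteq> i \<longrightarrow> x k = y k) \<and> x i = y i \<longleftrightarrow> x = y" for x y :: "'a \<Rightarrow> bool"
    by fastforce
  then show ?thesis by (auto simp: on_qubit_def mat_def vec_eq_iff)
qed

lemma on_qubit_minus: "on_qubit i (- U) = - on_qubit i U"
  by (auto simp: on_qubit_def vec_eq_iff)

section \<open>Commutation of operators on different qubits\<close>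

text \<open>Entrywise form of "identity on qubit \<open>k\<close> tensored with an operator on the
  rest"; the index type need not be split into tensor factors.\<close>

definition acts_trivially_on :: "'q::finite \<Rightarrow> 'q operator \<Rightarrow> bool" where
  "acts_trivially_on k A \<longleftrightarrow>
     (\<forall>x y. x k \<noteq> y k \<longrightarrow> A $ x $ y = 0) \<and>
     (\<forall>x y s. x k = y k \<longrightarrow> A $ (x(k := s)) $ (y(k := s)) = A $ x $ y)"

text \<open>\<open>A\<close> preserves bit \<open>k\<close>, so each of the two products has a
  single surviving term. These terms agree because resetting bit \<open>k\<close> in both indices at
  once does not change the entry of \<open>A\<close>.\<close>

lemma on_qubit_commute:
  assumes "acts_trivially_on k A"
  shows "on_qubit k U ** A = A ** on_qubit k U"
proof -
  have 0: "A $ x $ y = 0" if "x k \<noteq> y k" for x y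
    using assms that by (auto simp: acts_trivially_on_def)
  have 1: "A $ (x(k := y k)) $ y = A $ x $ (y(k := x k))" for x y
    using assms unfolding acts_trivially_on_def
    by (metis fun_upd_same fun_upd_triv fun_upd_upd)
  have "(\<Sum>s\<in>UNIV. U $ x k $ s * A $ (x(k := s)) $ y) =
        (\<Sum>s\<in>UNIV. A $ x $ (y(k := s)) * U $ s $ y k)" for x y
  proof -
    have "(\<Sum>s\<in>UNIV. U $ x k $ s * A $ (x(k := s)) $ y) = U $ x k $ y k * A $ (x(k := y k)) $ y"
      by (subst sum.mono_neutral_right[of UNIV "{y k}"]) (auto intro!: 0)
    moreover have "(\<Sum>s\<in>UNIV. A $ x $ (y(k := s)) * U $ s $ y k) = A $ x $ (y(k := x k)) * U $ x k $ y k"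
      by (subst sum.mono_neutral_right[of UNIV "{x k}"]) (auto intro!: 0)
    ultimately show ?thesis using 1 by simp
  qed
  then show ?thesis by (simp add: vec_eq_iff on_qubit_mult_nth mult_on_qubit_nth)
qed

lemma acts_trivially_on_qubit: "k \<noteq> i \<Longrightarrow> acts_trivially_on k (on_qubit i U)"
  by (auto simp: acts_trivially_on_def on_qubit_def)

lemma acts_trivially_on_projector: "k \<notin> qubits \<Phi> \<Longrightarrow> acts_trivially_on k (projector \<Phi>)"
  by (cases \<Phi>) (auto simp: acts_trivially_on_def)

lemma projector_adjoint [simp]: "hermitian_adjoint (projector \<Phi>) = projector \<Phi>"
  by (cases \<Phi>) (auto simp: hermitian_adjoint_def vec_eq_iff)

lemma sum_cnj_mult_norm: "(\<Sum>p\<in>UNIV. \<phi> $ p * cnj (\<phi> $ p)) = of_real ((norm \<phi>)\<^sup>2)"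
  by (simp add: norm_vec_def L2_set_def sum_nonneg complex_norm_square[symmetric])

lemma projector_idem:
  assumes "valid_clause \<Phi>"
  shows "projector \<Phi> ** projector \<Phi> = projector \<Phi>"
proof -
  obtain i j \<phi> where \<Phi>: "\<Phi> = (i, j, \<phi>)" by (cases \<Phi>) auto
  have ij: "i \<noteq> j" and n: "norm \<phi> = 1" using assms by (auto simp: \<Phi>)
  have "(projector \<Phi> ** projector \<Phi>) $ x $ y = projector \<Phi> $ x $ y" for x y
  proof -
    have "(projector \<Phi> ** projector \<Phi>) $ x $ y =
       (\<Sum>z\<in>UNIV. if \<forall>k. k \<noteq> i \<and> k \<noteq> j \<longrightarrow> x k = z k
         then projector \<Phi> $ x $ z * projector \<Phi> $ z $ y else 0)"
      by (auto simp: matrix_matrix_mult_def \<Phi> intro!: sum.cong)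
    also have "\<dots> = (\<Sum>p\<in>UNIV. projector \<Phi> $ x $ (x(i := fst p, j := snd p)) *
        projector \<Phi> $ (x(i := fst p, j := snd p)) $ y)"
      using ij by (rule sum_agree_off2)
    \<comment> \<open>The rank-one form lets the outer factors recombine to the entry at
      \<open>x\<close>, \<open>y\<close>; what remains of the inner sum is the squared norm of the
      clause vector, which is 1.\<close>
    also have "\<dots> = (\<Sum>p\<in>UNIV. projector \<Phi> $ x $ y * (\<phi> $ p * cnj (\<phi> $ p)))"
      using ij by (intro sum.cong) (auto simp: \<Phi>)
    also have "\<dots> = projector \<Phi> $ x $ y"
      by (subst sum_distrib_left[symmetric]) (simp only: sum_cnj_mult_norm n, simp)
    finally show ?thesis .
  qed
  then show ?thesis by (simp add: vec_eq_iff)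
qed

subsection \<open>Pauli operators in the bases of a YES instance\<close>

definition basis_matrix :: "(bool \<Rightarrow> complex ^ bool) \<Rightarrow> complex ^ bool ^ bool" where
  "basis_matrix e = (\<chi> p s. e s $ p)"

definition sigma_z :: "complex ^ bool ^ bool" where
  "sigma_z = (\<chi> s t. if s = t then (if s then -1 else 1) else 0)"

definition sigma_x :: "complex ^ bool ^ bool" where
  "sigma_x = (\<chi> s t. if s = t then 0 else 1)"

text \<open>\<open>A\<close> is read in the hidden basis \<open>e\<close>, the result in the
  reference basis, in which clauses and random unitaries are written.\<close>

definition in_basis :: "(bool \<Rightarrow> complex ^ bool) \<Rightarrow> complex ^ bool ^ bool \<Rightarrow> complex ^ bool ^ bool" where
  "in_basis e A = basis_matrix e ** A ** hermitian_adjoint (basis_matrix e)"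

lemma sigma_simps:
  "sigma_z ** sigma_z = mat 1" "sigma_x ** sigma_x = mat 1" "sigma_x ** sigma_z ** sigma_x = - sigma_z"
  "hermitian_adjoint sigma_z = sigma_z" "hermitian_adjoint sigma_x = sigma_x"
  by (auto simp: sigma_z_def sigma_x_def vec_eq_iff matrix_matrix_mult_def mat_def UNIV_bool
      hermitian_adjoint_def)

context
  fixes e assumes e: "orthonormal_basis e"
begin

lemma basis_matrix_unitary:
  "hermitian_adjoint (basis_matrix e) ** basis_matrix e = mat 1"
  "basis_matrix e ** hermitian_adjoint (basis_matrix e) = mat 1"
proof -
  show 1: "hermitian_adjoint (basis_matrix e) ** basis_matrix e = mat 1"
    using e by (simp add: orthonormal_basis_def vec_eq_iff matrix_matrix_mult_def mat_def
        hermitian_adjoint_def basis_matrix_def)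
  then show "basis_matrix e ** hermitian_adjoint (basis_matrix e) = mat 1"
    by (simp add: matrix_left_right_inverse)
qed

lemma in_basis_mult: "in_basis e A ** in_basis e D = in_basis e (A ** D)"
proof -
  have "in_basis e A ** in_basis e D = basis_matrix e ** A **
      (hermitian_adjoint (basis_matrix e) ** basis_matrix e) ** D ** hermitian_adjoint (basis_matrix e)"
    by (simp only: in_basis_def matrix_mul_assoc)
  then show ?thesis by (simp add: basis_matrix_unitary in_basis_def matrix_mul_assoc)
qed

lemma in_basis_one: "in_basis e (mat 1) = mat 1"
  by (simp add: in_basis_def basis_matrix_unitary)

lemma in_basis_minus: "in_basis e (- A) = - in_basis e A"
  by (simp add: in_basis_def matrix_distribs)

lemma in_basis_adjoint: "hermitian_adjoint (in_basis e A) = in_basis e (hermitian_adjoint A)"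
  by (simp add: in_basis_def matrix_mul_assoc)

lemma unitary_in_basis_sigma_x: "unitary (in_basis e sigma_x)"
  by (simp add: unitary_def in_basis_adjoint in_basis_mult sigma_simps in_basis_one)

lemma sigma_z_eigenvector:
  "(\<Sum>s\<in>UNIV. in_basis e sigma_z $ p $ s * e u $ s) = (if u then -1 else 1) * e u $ p"
proof -
  \<comment> \<open>Column \<open>u\<close> of \<open>basis_matrix e\<close> is the vector
    \<open>e u\<close>, so column \<open>u\<close> of this identity is the eigenvector
    equation.\<close>
  have "in_basis e sigma_z ** basis_matrix e = basis_matrix e ** sigma_z"
    by (metis basis_matrix_unitary(1) in_basis_def matrix_mul_assoc matrix_mul_rid)
  then have "(in_basis e sigma_z ** basis_matrix e) $ p $ u = (basis_matrix e ** sigma_z) $ p $ u"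
    by simp
  then show ?thesis
    by (cases u) (simp_all add: matrix_matrix_mult_def basis_matrix_def sigma_z_def UNIV_bool)
qed

end

definition pauli_z :: "('q::finite \<Rightarrow> bool \<Rightarrow> complex ^ bool) \<Rightarrow> 'q \<Rightarrow> 'q operator" where
  "pauli_z e k = on_qubit k (in_basis (e k) sigma_z)"

text \<open>The flip of a qubit in its hidden basis. It negates \<open>pauli_z e k\<close>, so
  averaging over it removes the terms linear in that operator, just as full resampling does.\<close>

definition pauli_x :: "('q::finite \<Rightarrow> bool \<Rightarrow> complex ^ bool) \<Rightarrow> 'q \<Rightarrow> 'q operator" where
  "pauli_x e k = on_qubit k (in_basis (e k) sigma_x)"

definition magnetization :: "('q::finite \<Rightarrow> bool \<Rightarrow> complex ^ bool) \<Rightarrow> 'q operator" where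
  "magnetization e = (\<Sum>k\<in>UNIV. pauli_z e k)"

locale qubit_bases =
  fixes e :: "'q::finite \<Rightarrow> bool \<Rightarrow> complex ^ bool"
  assumes orthonormal: "orthonormal_basis (e i)"
begin

lemma pauli_z_square: "pauli_z e k ** pauli_z e k = mat 1"
  by (simp add: pauli_z_def on_qubit_mult in_basis_mult[OF orthonormal] sigma_simps in_basis_one[OF orthonormal])

lemma pauli_x_square: "pauli_x e k ** pauli_x e k = mat 1"
  by (simp add: pauli_x_def on_qubit_mult in_basis_mult[OF orthonormal] sigma_simps in_basis_one[OF orthonormal])

lemma pauli_adjoint:
  "hermitian_adjoint (pauli_z e k) = pauli_z e k" "hermitian_adjoint (pauli_x e k) = pauli_x e k"
  by (simp_all add: pauli_z_def pauli_x_def in_basis_adjoint[OF orthonormal] sigma_simps)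

lemma pauli_z_commute: "pauli_z e k ** pauli_z e l = pauli_z e l ** pauli_z e k"
  by (cases "k = l") (auto simp: pauli_z_def intro!: on_qubit_commute acts_trivially_on_qubit)

lemma magnetization_adjoint: "hermitian_adjoint (magnetization e) = magnetization e"
  by (simp add: magnetization_def pauli_adjoint)

lemma magnetization_pauli_z_commute:
  "magnetization e ** pauli_z e k = pauli_z e k ** magnetization e"
  by (simp add: magnetization_def matrix_sum_distribs pauli_z_commute)

lemma magnetization_minus: "magnetization e - pauli_z e i = (\<Sum>k\<in>UNIV - {i}. pauli_z e k)"
  by (simp add: magnetization_def sum_diff1)

text \<open>After removal of the term of qubit \<open>i\<close>, only operators on other qubits are
  left in the sum.\<close>

lemma magnetization_minus_commute:
  "on_qubit i U ** (magnetization e - pauli_z e i) = (magnetization e - pauli_z e i) ** on_qubit i U"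
  unfolding magnetization_minus matrix_sum_distribs
  by (rule sum.cong) (auto simp: pauli_z_def intro!: on_qubit_commute acts_trivially_on_qubit)

text \<open>Conjugation by the flip fixes the part of the magnetization off qubit \<open>i\<close>
  and negates the rest.\<close>

lemma pauli_x_conj_magnetization:
  "pauli_x e i ** magnetization e ** pauli_x e i = magnetization e - 2 *\<^sub>R pauli_z e i"
proof -
  let ?X = "pauli_x e i" and ?Z = "pauli_z e i"
  have "?X ** (magnetization e - ?Z) ** ?X = (magnetization e - ?Z) ** (?X ** ?X)"
    using magnetization_minus_commute[of i "in_basis (e i) sigma_x"]
    by (simp add: pauli_x_def[symmetric] matrix_mul_assoc)
  moreover have "?X ** ?Z ** ?X = - ?Z"
    by (simp add: pauli_x_def pauli_z_def on_qubit_mult in_basis_mult[OF orthonormal] sigma_simps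
        in_basis_minus[OF orthonormal] on_qubit_minus)
  ultimately have "?X ** magnetization e ** ?X - - ?Z = magnetization e - ?Z"
    by (simp add: matrix_distribs pauli_x_square)
  then show ?thesis by (simp add: scaleR_2 algebra_simps)
qed

text \<open>In both product vectors of the clause one qubit is in state 0 and the other in state 1,
  so the two signs cancel. The facts \<open>i\<close> and \<open>j\<close> compute the two images of
  the clause vector and show them to be negatives of each other.\<close>

lemma pauli_z_sum_projector:
  assumes "restricted_clause e (i, j, \<phi>)" "i \<noteq> j"
  shows "(pauli_z e i + pauli_z e j) ** projector (i, j, \<phi>) = 0"
proof -
  obtain a b where \<phi>: "\<phi> = a *s tensor (e i False) (e j True) + b *s tensor (e i True) (e j False)"
    using assms by auto
  let ?Zi = "in_basis (e i) sigma_z" and ?Zj = "in_basis (e j) sigma_z"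
  have i: "(\<Sum>s\<in>UNIV. ?Zi $ p $ s * \<phi> $ (s, q)) =
      a * (e i False $ p * e j True $ q) - b * (e i True $ p * e j False $ q)" for p q
  proof -
    have "(\<Sum>s\<in>UNIV. ?Zi $ p $ s * \<phi> $ (s, q)) =
        a * e j True $ q * (\<Sum>s\<in>UNIV. ?Zi $ p $ s * e i False $ s) +
        b * e j False $ q * (\<Sum>s\<in>UNIV. ?Zi $ p $ s * e i True $ s)"
      by (simp add: \<phi> tensor_def sum_distrib_left sum.distrib algebra_simps)
    then show ?thesis by (simp add: sigma_z_eigenvector[OF orthonormal])
  qed
  have j: "(\<Sum>s\<in>UNIV. ?Zj $ q $ s * \<phi> $ (p, s)) =
      b * (e i True $ p * e j False $ q) - a * (e i False $ p * e j True $ q)" for p q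
  proof -
    have "(\<Sum>s\<in>UNIV. ?Zj $ q $ s * \<phi> $ (p, s)) =
        a * e i False $ p * (\<Sum>s\<in>UNIV. ?Zj $ q $ s * e j True $ s) +
        b * e i True $ p * (\<Sum>s\<in>UNIV. ?Zj $ q $ s * e j False $ s)"
      by (simp add: \<phi> tensor_def sum_distrib_left sum.distrib algebra_simps)
    then show ?thesis by (simp add: sigma_z_eigenvector[OF orthonormal])
  qed
  have "((pauli_z e i + pauli_z e j) ** projector (i, j, \<phi>)) $ x $ y = 0" for x y
  proof (cases "\<forall>k. k \<noteq> i \<and> k \<noteq> j \<longrightarrow> x k = y k")
    case True
    then have "(pauli_z e i ** projector (i, j, \<phi>)) $ x $ y =
        (\<Sum>s\<in>UNIV. ?Zi $ x i $ s * \<phi> $ (s, x j)) * cnj (\<phi> $ (y i, y j))"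
      and "(pauli_z e j ** projector (i, j, \<phi>)) $ x $ y =
        (\<Sum>s\<in>UNIV. ?Zj $ x j $ s * \<phi> $ (x i, s)) * cnj (\<phi> $ (y i, y j))"
      using assms(2) by (simp_all add: pauli_z_def on_qubit_mult_nth sum_distrib_right mult.assoc)
    then show ?thesis by (simp only: matrix_distribs vector_add_component i j) (simp add: algebra_simps)
  next
    case False
    then have "projector (i, j, \<phi>) $ (x(k := s)) $ y = 0" if "k \<in> {i, j}" for k s
      using that by auto
    then show ?thesis
      by (simp add: matrix_distribs pauli_z_def on_qubit_mult_nth del: projector.simps)
  qed
  then show ?thesis by (simp add: vec_eq_iff)
qed

lemma magnetization_projector_commute:
  assumes "restricted_clause e \<Phi>" "valid_clause \<Phi>"
  shows "magnetization e ** projector \<Phi> = projector \<Phi> ** magnetization e"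
proof -
  obtain i j \<phi> where \<Phi>: "\<Phi> = (i, j, \<phi>)" by (cases \<Phi>) auto
  have ij: "i \<noteq> j" using assms by (simp add: \<Phi>)
  define R where "R = (\<Sum>k\<in>UNIV - {i, j}. pauli_z e k)"
  have M: "magnetization e = R + (pauli_z e i + pauli_z e j)"
    using ij by (simp add: magnetization_def R_def sum.subset_diff[of "{i, j}" UNIV])
  have R: "R ** projector \<Phi> = projector \<Phi> ** R"
    unfolding R_def matrix_sum_distribs
    by (rule sum.cong) (auto simp: pauli_z_def \<Phi> intro!: on_qubit_commute acts_trivially_on_projector
      simp del: projector.simps)
  have 0: "(pauli_z e i + pauli_z e j) ** projector \<Phi> = 0"
    using assms ij unfolding \<Phi> by (intro pauli_z_sum_projector) auto
  \<comment> \<open>All operators here are self-adjoint, so annihilation from the left gives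
    annihilation from the right.\<close>
  then have "hermitian_adjoint ((pauli_z e i + pauli_z e j) ** projector \<Phi>) = 0" by simp
  then have "projector \<Phi> ** (pauli_z e i + pauli_z e j) = 0" by (simp add: pauli_adjoint)
  with 0 R show ?thesis by (simp only: M matrix_distribs(1,2)[of R "pauli_z e i + pauli_z e j"]
      matrix_distribs(2)[of _ R "pauli_z e i + pauli_z e j"])
qed

end

subsection \<open>The potential\<close>

text \<open>The factor \<open>re_trace \<rho>\<close> makes this linear in \<open>\<rho>\<close>, so
  that it also applies to unnormalised post-measurement operators.\<close>

definition potential :: "('q::finite \<Rightarrow> bool \<Rightarrow> complex ^ bool) \<Rightarrow> 'q operator \<Rightarrow> real" where
  "potential e \<rho> = ((real CARD('q))\<^sup>2 * re_trace \<rho> -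
     re_trace (magnetization e ** magnetization e ** \<rho>)) / 2"

text \<open>The potential of \<open>\<rho>\<close> after qubit \<open>i\<close> has been replaced by the maximally mixed state.\<close>

definition resampled_potential ::
    "('q::finite \<Rightarrow> bool \<Rightarrow> complex ^ bool) \<Rightarrow> 'q \<Rightarrow> 'q operator \<Rightarrow> real" where
  "resampled_potential e i \<rho> =
     potential e \<rho> + re_trace (magnetization e ** pauli_z e i ** \<rho>) - re_trace \<rho>"

lemma potential_scaleR: "potential e (r *\<^sub>R \<rho>) = r * potential e \<rho>"
  by (simp add: potential_def matrix_distribs re_trace_simps algebra_simps)

lemma resampled_potential_scaleR:
  "resampled_potential e i (r *\<^sub>R \<rho>) = r * resampled_potential e i \<rho>"
  by (simp add: resampled_potential_def potential_scaleR matrix_distribs re_trace_simps algebra_simps)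

lemma trace_rotate: "trace (A ** B ** D) = trace (D ** A ** B)"
  for A B D :: "complex ^ 'n ^ 'n"
  by (metis matrix_mul_assoc trace_mul_sym)

text \<open>For a projector \<open>Q\<close> commuting with \<open>A\<close>, cyclicity of the trace
  absorbs one of the two copies of \<open>Q\<close>. Applied to \<open>P\<close> and its complement,
  the two remaining factors add up to the identity.\<close>

lemma re_trace_pinching:
  fixes A P :: "complex ^ 'n ^ 'n"
  assumes AP: "A ** P = P ** A" and PP: "P ** P = P"
  shows "re_trace (A ** (P ** \<rho> ** P)) + re_trace (A ** ((mat 1 - P) ** \<rho> ** (mat 1 - P))) =
    re_trace (A ** \<rho>)"
proof -
  have conj: "re_trace (A ** (Q ** \<rho> ** Q)) = re_trace (A ** Q ** \<rho>)"
    if "A ** Q = Q ** A" "Q ** Q = Q" for Q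
  proof -
    have "trace (A ** (Q ** \<rho> ** Q)) = trace (Q ** A ** Q ** \<rho>)"
      using trace_rotate[of A "Q ** \<rho>" Q] by (simp add: matrix_mul_assoc)
    also have "Q ** A ** Q = A ** (Q ** Q)" by (metis that(1) matrix_mul_assoc)
    finally show ?thesis using that by simp
  qed
  have "(mat 1 - P) ** (mat 1 - P) = mat 1 - P" using PP by (simp add: matrix_distribs)
  moreover have "A ** (mat 1 - P) = (mat 1 - P) ** A" using AP by (simp add: matrix_distribs)
  ultimately show ?thesis using assms
    by (simp add: conj) (simp add: matrix_distribs re_trace_simps)
qed

context qubit_bases
begin

text \<open>The square of the magnetization is a sum of \<open>n^2\<close> products of two Pauli
  operators. Each product is a self-adjoint involution, so its expectation is at most the trace; no
  diagonalisation is required.\<close>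

lemma potential_nonneg:
  assumes "positive_matrix \<rho>"
  shows "0 \<le> potential e \<rho>"
proof -
  have pair: "re_trace (pauli_z e k ** pauli_z e l ** \<rho>) \<le> re_trace \<rho>" for k l
  proof -
    let ?W = "pauli_z e k ** pauli_z e l"
    define B where "B = mat 1 - ?W"
    have adj: "hermitian_adjoint B = B"
      by (simp add: B_def pauli_adjoint pauli_z_commute)
    have "?W ** ?W = pauli_z e k ** (pauli_z e l ** pauli_z e k) ** pauli_z e l"
      by (simp only: matrix_mul_assoc)
    also have "\<dots> = (pauli_z e k ** pauli_z e k) ** (pauli_z e l ** pauli_z e l)"
      by (simp only: matrix_mul_assoc pauli_z_commute[of l k])
    finally have "?W ** ?W = mat 1" by (simp add: pauli_z_square)
    \<comment> \<open>Half of \<open>B\<close> is the projector onto the eigenvalue -1 of the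
      involution, which makes the expectation of \<open>B\<close> nonnegative.\<close>
    then have "B ** B = 2 *\<^sub>R B" by (simp add: B_def matrix_distribs scaleR_2)
    moreover have "0 \<le> re_trace (hermitian_adjoint B ** B ** \<rho>)"
      by (rule positive_matrix_re_trace_mult[OF assms])
    ultimately have "0 \<le> 2 * re_trace (B ** \<rho>)" by (simp add: adj matrix_distribs re_trace_simps)
    then show ?thesis by (simp add: B_def matrix_distribs re_trace_simps)
  qed
  have "re_trace (magnetization e ** magnetization e ** \<rho>) =
      (\<Sum>k\<in>UNIV. \<Sum>l\<in>UNIV. re_trace (pauli_z e k ** pauli_z e l ** \<rho>))"
    unfolding magnetization_def matrix_sum_distribs re_trace_sum by (rule sum.swap)
  also have "\<dots> \<le> (\<Sum>k\<in>(UNIV::'q set). \<Sum>l\<in>(UNIV::'q set). re_trace \<rho>)"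
    by (intro sum_mono pair)
  finally show ?thesis by (simp add: potential_def power2_eq_square algebra_simps)
qed

text \<open>With \<open>M\<close> and \<open>Z\<close> for the magnetization and the Pauli operator,
  \<open>(M - 2 Z)^2 = M^2 - 4 M Z + 4\<close>; the mean of this and \<open>M^2\<close> is
  \<open>(M - Z)^2 + 1\<close>, the square after resampling.\<close>

lemma potential_pauli_x_conj:
  "potential e (pauli_x e i ** \<rho> ** pauli_x e i) + potential e \<rho> = 2 * resampled_potential e i \<rho>"
proof -
  let ?X = "pauli_x e i" and ?Z = "pauli_z e i" and ?M = "magnetization e"
  have XX: "?X ** ?X = mat 1" by (rule pauli_x_square)
  have "?X ** (?M ** ?M) ** ?X = (?X ** ?M) ** (?X ** ?X) ** (?M ** ?X)"
    by (simp add: XX matrix_mul_assoc)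
  also have "\<dots> = (?X ** ?M ** ?X) ** (?X ** ?M ** ?X)" by (simp only: matrix_mul_assoc)
  also have "\<dots> = (?M - 2 *\<^sub>R ?Z) ** (?M - 2 *\<^sub>R ?Z)"
    by (simp only: pauli_x_conj_magnetization)
  also have "\<dots> = ?M ** ?M - 4 *\<^sub>R (?M ** ?Z) + 4 *\<^sub>R mat 1"
    by (simp add: matrix_distribs pauli_z_square magnetization_pauli_z_commute[symmetric]
        algebra_simps flip: scaleR_add_left)
  finally have XMX: "?X ** (?M ** ?M) ** ?X = ?M ** ?M - 4 *\<^sub>R (?M ** ?Z) + 4 *\<^sub>R mat 1" .
  have "trace (?M ** ?M ** (?X ** \<rho> ** ?X)) = trace (?X ** (?M ** ?M) ** ?X ** \<rho>)"
    using trace_rotate[of "?M ** ?M" "?X ** \<rho>" ?X] by (simp add: matrix_mul_assoc)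
  moreover have "trace (?X ** \<rho> ** ?X) = trace \<rho>"
    by (subst trace_rotate) (simp add: XX)
  ultimately show ?thesis
    by (simp add: XMX potential_def resampled_potential_def matrix_distribs re_trace_simps field_simps)
qed

lemma resampled_potential_rotate:
  assumes "unitary U"
  shows "resampled_potential e i (rotate_qubit i U \<rho>) = resampled_potential e i \<rho>"
proof -
  let ?Z = "pauli_z e i" and ?M = "magnetization e" and ?U = "on_qubit i U"
  have UU: "hermitian_adjoint ?U ** ?U = mat 1"
    using assms by (simp add: unitary_def on_qubit_mult)
  \<comment> \<open>Completing the square with \<open>Z_i^2 = 1\<close> leaves only operators that
    do not touch qubit \<open>i\<close>; invariance under rotations of that qubit is then
    visible.\<close>
  have alt: "resampled_potential e i \<sigma> =
      (((real CARD('q))\<^sup>2 - 1) * re_trace \<sigma> - re_trace ((?M - ?Z) ** (?M - ?Z) ** \<sigma>)) / 2" for \<sigma>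
    unfolding resampled_potential_def potential_def
    by (simp only: matrix_distribs re_trace_simps pauli_z_square matrix_mul_lid
        magnetization_pauli_z_commute[of i, symmetric]) (simp add: field_simps)
  have tr: "trace (A ** rotate_qubit i U \<rho>) = trace (A ** \<rho>)" if "?U ** A = A ** ?U" for A
  proof -
    have "trace (A ** rotate_qubit i U \<rho>) = trace (hermitian_adjoint ?U ** (A ** ?U) ** \<rho>)"
      using trace_rotate[of A "?U ** \<rho>" "hermitian_adjoint ?U"]
      by (simp add: rotate_qubit_def matrix_mul_assoc del: on_qubit_adjoint)
    also have "hermitian_adjoint ?U ** (A ** ?U) = (hermitian_adjoint ?U ** ?U) ** A"
      by (simp only: that[symmetric] matrix_mul_assoc)
    finally show ?thesis by (simp only: UU matrix_mul_lid)
  qed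
  have "?U ** ((?M - ?Z) ** (?M - ?Z)) = (?M - ?Z) ** (?M - ?Z) ** ?U"
    by (simp only: matrix_mul_assoc magnetization_minus_commute)
      (simp only: matrix_mul_assoc[symmetric] magnetization_minus_commute)
  from tr[OF this] tr[of "mat 1"] show ?thesis by (simp add: alt)
qed

text \<open>The flip identity applied to the rotated state. Its value does not depend on
  \<open>U\<close>, so no integral over the unitary group has to be evaluated.\<close>

lemma potential_rotate_average:
  assumes "unitary U"
  shows "potential e (rotate_qubit i (in_basis (e i) sigma_x ** U) \<rho>) + potential e (rotate_qubit i U \<rho>) =
    2 * resampled_potential e i \<rho>"
proof -
  have "rotate_qubit i (in_basis (e i) sigma_x ** U) \<rho> =
      pauli_x e i ** rotate_qubit i U \<rho> ** hermitian_adjoint (pauli_x e i)"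
    unfolding rotate_qubit_def on_qubit_mult[symmetric] pauli_x_def
    by (simp add: matrix_mul_assoc del: on_qubit_adjoint)
  then show ?thesis
    using potential_pauli_x_conj[of i "rotate_qubit i U \<rho>"] assms
    by (simp add: pauli_adjoint resampled_potential_rotate)
qed

text \<open>Pinching is applied to the square of the magnetization and to the identity, both of
  which commute with the clause.\<close>

lemma potential_pinching:
  assumes "restricted_clause e \<Phi>" "valid_clause \<Phi>"
  defines "P \<equiv> projector \<Phi>"
  shows "potential e (P ** \<rho> ** P) + potential e ((mat 1 - P) ** \<rho> ** (mat 1 - P)) = potential e \<rho>"
proof -
  let ?M = "magnetization e"
  have PP: "P ** P = P" unfolding P_def by (rule projector_idem) fact
  have MP: "?M ** P = P ** ?M" unfolding P_def by (rule magnetization_projector_commute) fact+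
  have "?M ** ?M ** P = P ** (?M ** ?M)" by (metis MP matrix_mul_assoc)
  from re_trace_pinching[OF this PP, of \<rho>]
  have "re_trace (?M ** ?M ** \<rho>) = re_trace (?M ** ?M ** (P ** \<rho> ** P)) +
      re_trace (?M ** ?M ** ((mat 1 - P) ** \<rho> ** (mat 1 - P)))" by simp
  moreover from re_trace_pinching[of "mat 1", OF _ PP, of \<rho>]
  have "re_trace \<rho> = re_trace (P ** \<rho> ** P) + re_trace ((mat 1 - P) ** \<rho> ** (mat 1 - P))" by simp
  ultimately show ?thesis
    by (simp add: potential_def distrib_left diff_divide_distrib add_divide_distrib)
qed

text \<open>The cross terms of the two qubits may be nonzero separately, but their sum contains
  \<open>(Z_i + Z_j) P = 0\<close>. This is where the uniform choice between the two qubits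
  enters.\<close>

lemma resampled_potential_projected:
  assumes "restricted_clause e (i, j, \<phi>)" "valid_clause (i, j, \<phi>)"
  defines "P \<equiv> projector (i, j, \<phi>)"
  shows "resampled_potential e i (P ** \<rho> ** P) + resampled_potential e j (P ** \<rho> ** P) =
    2 * potential e (P ** \<rho> ** P) - 2 * re_trace (P ** \<rho> ** P)"
proof -
  let ?M = "magnetization e" and ?\<sigma> = "P ** \<rho> ** P"
  have 0: "(pauli_z e i + pauli_z e j) ** P = 0"
    unfolding P_def using assms by (intro pauli_z_sum_projector) auto
  have "?M ** pauli_z e i ** ?\<sigma> + ?M ** pauli_z e j ** ?\<sigma> =
      ?M ** ((pauli_z e i + pauli_z e j) ** P) ** \<rho> ** P"
    by (simp only: matrix_distribs(1) matrix_distribs(2)[of ?M] matrix_mul_assoc)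
  also have "\<dots> = 0" unfolding 0 by (simp only: matrix_distribs(9,10))
  finally have "re_trace (?M ** pauli_z e i ** ?\<sigma> + ?M ** pauli_z e j ** ?\<sigma>) = 0"
    by (simp only: re_trace_simps)
  then show ?thesis by (simp add: resampled_potential_def re_trace_simps)
qed

end

subsection \<open>Measurements\<close>

context
  fixes \<Phi> :: "'q::finite clause" and \<rho> :: "'q operator"
  assumes \<Phi>: "valid_clause \<Phi>" and \<rho>: "density_matrix \<rho>"
begin

lemma outcome1_prob_eq: "re_trace (projector \<Phi> ** \<rho> ** projector \<Phi>) = outcome1_prob \<Phi> \<rho>"
proof -
  have "trace (projector \<Phi> ** \<rho> ** projector \<Phi>) = trace (projector \<Phi> ** projector \<Phi> ** \<rho>)"
    by (rule trace_rotate)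
  then show ?thesis by (simp add: outcome1_prob_def projector_idem[OF \<Phi>])
qed

lemma outcome0_prob_eq:
  "re_trace ((mat 1 - projector \<Phi>) ** \<rho> ** (mat 1 - projector \<Phi>)) = 1 - outcome1_prob \<Phi> \<rho>"
  using re_trace_pinching[of "mat 1" "projector \<Phi>" \<rho>] outcome1_prob_eq \<rho>
  by (simp add: projector_idem[OF \<Phi>] density_matrix_def)

lemma positive_matrix_projected:
  "positive_matrix (projector \<Phi> ** \<rho> ** projector \<Phi>)"
  "positive_matrix ((mat 1 - projector \<Phi>) ** \<rho> ** (mat 1 - projector \<Phi>))"
  using positive_matrix_conj[of \<rho> "projector \<Phi>"] positive_matrix_conj[of \<rho> "mat 1 - projector \<Phi>"] \<rho>
  by (simp_all add: density_matrix_def)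

lemma outcome1_prob_bounds: "0 \<le> outcome1_prob \<Phi> \<rho>" "outcome1_prob \<Phi> \<rho> \<le> 1"
  using positive_matrix_re_trace[OF positive_matrix_projected(1)]
    positive_matrix_re_trace[OF positive_matrix_projected(2)]
  by (simp_all add: outcome1_prob_eq outcome0_prob_eq)

lemma density_matrix_post1: "outcome1_prob \<Phi> \<rho> \<noteq> 0 \<Longrightarrow> density_matrix (post1 \<Phi> \<rho>)"
  using outcome1_prob_bounds positive_matrix_projected
  by (simp add: density_matrix_def post1_def positive_matrix_scaleR re_trace_simps outcome1_prob_eq)

lemma density_matrix_post0: "outcome1_prob \<Phi> \<rho> \<noteq> 1 \<Longrightarrow> density_matrix (post0 \<Phi> \<rho>)"
  using outcome1_prob_bounds positive_matrix_projected
  by (simp add: density_matrix_def post0_def positive_matrix_scaleR re_trace_simps outcome0_prob_eq)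

text \<open>A clause found satisfied stays satisfied when it is measured again. The case of outcome
  probability 1 is included: \<open>post0\<close> is then the zero matrix.\<close>

lemma outcome1_prob_post0: "outcome1_prob \<Phi> (post0 \<Phi> \<rho>) = 0"
proof -
  have "projector \<Phi> ** (mat 1 - projector \<Phi>) = 0"
    by (simp add: matrix_distribs projector_idem[OF \<Phi>])
  then show ?thesis
    by (simp only: outcome1_prob_def post0_def matrix_distribs(8) matrix_mul_assoc)
      (simp add: matrix_distribs re_trace_simps)
qed

end

text \<open>The weights \<open>p\<close> and \<open>1 - p\<close> undo the normalisation, and
  pinching splits the potential between the unnormalised operators. An inequality suffices, since
  for an outcome of probability 0 nonnegativity of its share already settles the claim.\<close>

lemma (in qubit_bases) potential_step:
  assumes \<Phi>: "valid_clause \<Phi>" and \<rho>: "density_matrix \<rho>"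
    and "restricted_clause e \<Phi>" and "\<Phi> = (i, j, \<phi>)"
  defines "p \<equiv> outcome1_prob \<Phi> \<rho>"
  shows "p * (1 + (resampled_potential e i (post1 \<Phi> \<rho>) + resampled_potential e j (post1 \<Phi> \<rho>)) / 2) +
    (1 - p) * potential e (post0 \<Phi> \<rho>) \<le> potential e \<rho>"
proof -
  let ?P = "projector \<Phi>"
  let ?\<sigma> = "?P ** \<rho> ** ?P" and ?\<tau> = "(mat 1 - ?P) ** \<rho> ** (mat 1 - ?P)"
  have pin: "potential e ?\<sigma> + potential e ?\<tau> = potential e \<rho>"
    using assms by (intro potential_pinching)
  have 1: "p * (1 + (resampled_potential e i (post1 \<Phi> \<rho>) + resampled_potential e j (post1 \<Phi> \<rho>)) / 2)
      \<le> potential e ?\<sigma>"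
  proof (cases "p = 0")
    case True
    then show ?thesis using potential_nonneg positive_matrix_projected[OF \<Phi> \<rho>] by simp
  next
    case False
    have "resampled_potential e i ?\<sigma> + resampled_potential e j ?\<sigma> = 2 * potential e ?\<sigma> - 2 * p"
      using resampled_potential_projected[of i j \<phi> \<rho>] assms outcome1_prob_eq[OF \<Phi> \<rho>] by simp
    with False show ?thesis
      by (simp add: post1_def resampled_potential_scaleR p_def[symmetric] field_simps)
  qed
  have 2: "(1 - p) * potential e (post0 \<Phi> \<rho>) \<le> potential e ?\<tau>"
  proof (cases "p = 1")
    case True
    then show ?thesis using potential_nonneg positive_matrix_projected[OF \<Phi> \<rho>] by simp
  qed (simp add: post0_def potential_scaleR p_def[symmetric] mult.assoc[symmetric])
  from 1 2 pin show ?thesis by simp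
qed

subsection \<open>Measurability\<close>

lemma continuous_on_matrix_mult:
  fixes f :: "'a::topological_space \<Rightarrow> complex ^ 'n ^ 'm" and g :: "'a \<Rightarrow> complex ^ 'k ^ 'n"
  assumes "continuous_on S f" "continuous_on S g"
  shows "continuous_on S (\<lambda>x. f x ** g x)"
  unfolding matrix_matrix_mult_def
  by (intro continuous_on_vec_lambda continuous_intros assms)

lemma continuous_on_hermitian_adjoint:
  fixes f :: "'a::topological_space \<Rightarrow> complex ^ 'n ^ 'm"
  assumes "continuous_on S f"
  shows "continuous_on S (\<lambda>x. hermitian_adjoint (f x))"
  unfolding hermitian_adjoint_def
  by (intro continuous_on_vec_lambda continuous_intros assms)

lemma continuous_on_on_qubit:
  assumes "continuous_on S f"
  shows "continuous_on S (\<lambda>x. on_qubit i (f x))"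
proof -
  have "continuous_on S (\<lambda>x. if b then f x $ s $ t else 0)" for b s t
    by (cases b) (auto intro!: continuous_intros assms)
  then show ?thesis unfolding on_qubit_def by (intro continuous_on_vec_lambda)
qed

lemma continuous_on_re_trace:
  fixes f :: "'a::topological_space \<Rightarrow> complex ^ 'n ^ 'n"
  assumes "continuous_on S f"
  shows "continuous_on S (\<lambda>x. re_trace (f x))"
  unfolding trace_def by (intro continuous_intros assms)

lemmas matrix_continuous_intros =
  continuous_on_matrix_mult continuous_on_hermitian_adjoint continuous_on_on_qubit
  continuous_on_re_trace continuous_on_id continuous_on_const

lemma measurable_outcome1_prob [measurable]: "outcome1_prob \<Phi> \<in> borel_measurable borel"
  unfolding outcome1_prob_def
  by (intro borel_measurable_continuous_onI matrix_continuous_intros)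

lemma measurable_post1 [measurable]: "post1 \<Phi> \<in> borel_measurable borel"
proof -
  have "(\<lambda>\<rho>. projector \<Phi> ** \<rho> ** projector \<Phi>) \<in> borel_measurable borel"
    by (intro borel_measurable_continuous_onI matrix_continuous_intros)
  then show ?thesis unfolding post1_def by measurable
qed

lemma measurable_post0 [measurable]: "post0 \<Phi> \<in> borel_measurable borel"
proof -
  have "(\<lambda>\<rho>. (mat 1 - projector \<Phi>) ** \<rho> ** (mat 1 - projector \<Phi>)) \<in> borel_measurable borel"
    by (intro borel_measurable_continuous_onI matrix_continuous_intros)
  then show ?thesis unfolding post0_def by measurable
qed

lemma measurable_rotate_qubit [measurable]:
  "(\<lambda>(U, \<rho>). rotate_qubit i U \<rho>) \<in> borel_measurable (borel \<Otimes>\<^sub>M borel)"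
  unfolding rotate_qubit_def borel_prod split_beta'
  by (intro borel_measurable_continuous_onI matrix_continuous_intros continuous_on_fst continuous_on_snd)

lemma measurable_bernoulli_pmf:
  assumes "p \<in> borel_measurable M"
  shows "(\<lambda>x. measure_pmf (bernoulli_pmf (p x))) \<in> M \<rightarrow>\<^sub>M prob_algebra (count_space UNIV)"
proof (rule measurable_prob_algebraI)
  show "(\<lambda>x. measure_pmf (bernoulli_pmf (p x))) \<in> M \<rightarrow>\<^sub>M subprob_algebra (count_space UNIV)"
  proof (rule measurable_subprob_algebra)
    fix A :: "bool set"
    \<comment> \<open>\<open>bernoulli_pmf\<close> clamps its parameter to the unit interval, so the
      kernel is defined and measurable on all operators and not only on states.\<close>
    have "emeasure (measure_pmf (bernoulli_pmf (p x))) A =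
        (\<Sum>b\<in>A. ennreal (if b then min 1 (max 0 (p x)) else 1 - min 1 (max 0 (p x))))" for x
      by (simp add: emeasure_measure_pmf_finite bernoulli_pmf.rep_eq)
    then show "(\<lambda>x. emeasure (measure_pmf (bernoulli_pmf (p x))) A) \<in> borel_measurable M"
      using assms by simp
  qed (auto intro: prob_space_imp_subprob_space measure_pmf.prob_space_axioms)
qed (rule measure_pmf.prob_space_axioms)

text \<open>With countably many intermediate values, joint measurability of \<open>G\<close> follows
  from measurability at each fixed value.\<close>

lemma measurable_bind_count_space:
  fixes K :: "'a \<Rightarrow> 'b::countable measure"
  assumes "K \<in> M \<rightarrow>\<^sub>M prob_algebra (count_space UNIV)"
    and "\<And>a. (\<lambda>x. G x a) \<in> M \<rightarrow>\<^sub>M prob_algebra R"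
  shows "(\<lambda>x. K x \<bind> G x) \<in> M \<rightarrow>\<^sub>M prob_algebra R"
proof (rule measurable_bind_prob_space2[OF assms(1)])
  show "(\<lambda>(x, y). G x y) \<in> M \<Otimes>\<^sub>M count_space UNIV \<rightarrow>\<^sub>M prob_algebra R"
    unfolding split_beta'
    by (rule measurable_compose_countable'[where f = "\<lambda>a z. G (fst z) a" and g = snd and I = UNIV])
      (auto intro: measurable_compose[OF measurable_fst assms(2)])
qed

lemma measure_pmf_in_prob_algebra: "measure_pmf p \<in> space (prob_algebra (count_space UNIV))"
  by (simp add: space_prob_algebra measure_pmf.prob_space_axioms)

section \<open>The kernels of the algorithm\<close>

locale haar =
  fixes \<mu> :: "(complex ^ bool ^ bool) measure"
  assumes haar: "haar_measure_U2 \<mu>"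
begin

lemma prob_space_haar: "prob_space \<mu>" and sets_haar [measurable_cong]: "sets \<mu> = sets borel"
  and AE_unitary: "AE U in \<mu>. unitary U"
  and haar_invariant: "unitary V \<Longrightarrow> distr \<mu> borel (\<lambda>U. V ** U) = \<mu>"
  using haar by (auto simp: haar_measure_U2_def)

text \<open>This and \<open>clause_step\<close> name the inner layers of
  \<open>algorithm_step\<close>, so that measurability is proved one layer at a time.\<close>

definition rotation_step :: "'q::finite clause \<Rightarrow> 'q operator \<Rightarrow> 'q \<Rightarrow> (bool \<times> 'q operator) measure" where
  "rotation_step \<Phi> \<rho> i = \<mu> \<bind> (\<lambda>U. return step_space (True, rotate_qubit i U (post1 \<Phi> \<rho>)))"

definition clause_step :: "'q::finite clause \<Rightarrow> 'q operator \<Rightarrow> bool \<Rightarrow> (bool \<times> 'q operator) measure" where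
  "clause_step \<Phi> \<rho> x =
     (if x then measure_pmf (pmf_of_set (qubits \<Phi>)) \<bind> rotation_step \<Phi> \<rho>
      else return step_space (False, post0 \<Phi> \<rho>))"

lemma algorithm_step_eq:
  "algorithm_step \<mu> L C \<rho> = measure_pmf (pmf_of_set {1..L}) \<bind> (\<lambda>\<alpha>.
     measure_pmf (bernoulli_pmf (outcome1_prob (C \<alpha>) \<rho>)) \<bind> clause_step (C \<alpha>) \<rho>)"
  unfolding algorithm_step_def clause_step_def rotation_step_def ..

lemma measurable_rotation_kernel:
  "(\<lambda>U. return step_space (True, rotate_qubit i U \<sigma>)) \<in> \<mu> \<rightarrow>\<^sub>M prob_algebra step_space"
  for \<sigma> :: "'q::finite operator"
proof (rule measurable_compose[OF _ measurable_return_prob_space])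
  have "(\<lambda>U. rotate_qubit i U \<sigma>) \<in> borel \<rightarrow>\<^sub>M borel"
    using measurable_rotate_qubit[of i] by simp
  then show "(\<lambda>U. (True, rotate_qubit i U \<sigma>)) \<in> \<mu> \<rightarrow>\<^sub>M step_space" by measurable
qed

lemma measurable_rotation_step:
  "(\<lambda>\<rho>. rotation_step \<Phi> \<rho> i) \<in> borel \<rightarrow>\<^sub>M prob_algebra step_space"
  for \<Phi> :: "'q::finite clause"
  unfolding rotation_step_def
proof (rule measurable_bind_prob_space2)
  show "(\<lambda>\<rho>. \<mu>) \<in> borel \<rightarrow>\<^sub>M prob_algebra borel"
    by (simp add: space_prob_algebra prob_space_haar sets_haar)
  have "(\<lambda>z. rotate_qubit i (snd z) (post1 \<Phi> (fst z))) \<in> (borel \<Otimes>\<^sub>M borel) \<rightarrow>\<^sub>M borel"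
    using measurable_compose[OF _ measurable_rotate_qubit[of i],
      of "\<lambda>z. (snd z, post1 \<Phi> (fst z))" "borel \<Otimes>\<^sub>M borel"] by simp
  then have "(\<lambda>z. (True, rotate_qubit i (snd z) (post1 \<Phi> (fst z)))) \<in> (borel \<Otimes>\<^sub>M borel) \<rightarrow>\<^sub>M step_space"
    by measurable
  from measurable_compose[OF this measurable_return_prob_space]
  show "(\<lambda>(\<rho>, U). return step_space (True, rotate_qubit i U (post1 \<Phi> \<rho>))) \<in>
      borel \<Otimes>\<^sub>M borel \<rightarrow>\<^sub>M prob_algebra step_space"
    by (simp add: split_beta')
qed

lemma measurable_clause_step:
  "(\<lambda>\<rho>. clause_step \<Phi> \<rho> x) \<in> borel \<rightarrow>\<^sub>M prob_algebra step_space"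
  for \<Phi> :: "'q::finite clause"
proof (cases x)
  case True
  then show ?thesis
    by (simp add: clause_step_def)
      (intro measurable_bind_count_space measurable_rotation_step measurable_const
        measure_pmf_in_prob_algebra)
next
  case False
  have "(\<lambda>\<rho>. (False, post0 \<Phi> \<rho>)) \<in> borel \<rightarrow>\<^sub>M step_space" by measurable
  from measurable_compose[OF this measurable_return_prob_space] False show ?thesis
    by (simp add: clause_step_def)
qed

lemma measurable_outcome_step:
  "(\<lambda>\<rho>. measure_pmf (bernoulli_pmf (outcome1_prob \<Phi> \<rho>)) \<bind> clause_step \<Phi> \<rho>)
    \<in> borel \<rightarrow>\<^sub>M prob_algebra step_space"
  by (intro measurable_bind_count_space measurable_clause_step measurable_bernoulli_pmf
      measurable_outcome1_prob)

lemma measurable_algorithm_step: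
  "algorithm_step \<mu> L C \<in> borel \<rightarrow>\<^sub>M prob_algebra step_space"
  unfolding algorithm_step_eq
  by (intro measurable_bind_count_space measurable_outcome_step measurable_const
      measure_pmf_in_prob_algebra)

lemma measurable_cons_outcome:
  assumes "K \<in> borel \<rightarrow>\<^sub>M prob_algebra (count_space UNIV)"
  shows "(\<lambda>(x, \<rho>). K \<rho> \<bind> (\<lambda>xs. return (count_space UNIV) (x # xs)))
    \<in> (step_space :: (bool \<times> 'q::finite operator) measure) \<rightarrow>\<^sub>M prob_algebra (count_space UNIV)"
proof -
  have "(\<lambda>\<rho>. K \<rho> \<bind> (\<lambda>xs. return (count_space UNIV) (x # xs)))
      \<in> borel \<rightarrow>\<^sub>M prob_algebra (count_space UNIV)" for x
    by (intro measurable_bind_count_space assms measurable_const)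
      (simp add: space_prob_algebra prob_space_return)
  then show ?thesis by (intro measurable_pair_measure_countable1) auto
qed

lemma measurable_outcomes_from:
  "outcomes_from \<mu> L C T \<in> borel \<rightarrow>\<^sub>M prob_algebra (count_space UNIV)"
proof (induction T)
  case 0
  then show ?case by (simp add: space_prob_algebra prob_space_return)
next
  case (Suc T)
  show ?case unfolding outcomes_from.simps
    by (intro measurable_bind_prob_space[OF measurable_algorithm_step] measurable_cons_outcome Suc)
qed

lemma prob_space_outcomes_from: "prob_space (outcomes_from \<mu> L C T \<rho>)"
  and sets_outcomes_from: "sets (outcomes_from \<mu> L C T \<rho>) = UNIV"
  using measurable_space[OF measurable_outcomes_from, of \<rho> L C T] by (auto simp: space_prob_algebra)

lemma measurable_nn_integral_outcomes_from:
  "(\<lambda>\<rho>. \<integral>\<^sup>+ xs. g xs \<partial>outcomes_from \<mu> L C T \<rho>) \<in> borel_measurable borel"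
  by (rule measurable_compose[OF measurable_prob_algebraD[OF measurable_outcomes_from]
        nn_integral_measurable_subprob_algebra]) simp

subsection \<open>Expectations of one step\<close>

text \<open>Conditioning on the first step; both inductions on the number of steps rest on
  it.\<close>

lemma nn_integral_outcomes_from_Suc:
  "(\<integral>\<^sup>+ xs. g xs \<partial>outcomes_from \<mu> L C (Suc T) \<rho>) =
   (\<integral>\<^sup>+ z. (\<integral>\<^sup>+ xs. g (fst z # xs) \<partial>outcomes_from \<mu> L C T (snd z)) \<partial>algorithm_step \<mu> L C \<rho>)"
proof -
  have cons: "(\<integral>\<^sup>+ xs. g xs \<partial>(outcomes_from \<mu> L C T \<rho>' \<bind> (\<lambda>xs. return (count_space UNIV) (x # xs)))) =
      (\<integral>\<^sup>+ xs. g (x # xs) \<partial>outcomes_from \<mu> L C T \<rho>')" for x \<rho>'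
  proof -
    have "(\<lambda>xs. return (count_space UNIV) (x # xs)) \<in>
        outcomes_from \<mu> L C T \<rho>' \<rightarrow>\<^sub>M subprob_algebra (count_space UNIV)"
      by (subst measurable_cong_sets[of _ "count_space UNIV", OF _ refl])
        (auto simp: sets_outcomes_from space_subprob_algebra prob_space_return
          intro!: prob_space_imp_subprob_space)
    then show ?thesis
      by (subst nn_integral_bind[where B = "count_space UNIV"]) (auto simp: nn_integral_return)
  qed
  have "algorithm_step \<mu> L C \<rho> \<in> space (prob_algebra step_space)"
    using measurable_space[OF measurable_algorithm_step, of \<rho>] by simp
  then have "sets (algorithm_step \<mu> L C \<rho>) = sets step_space" by (simp add: space_prob_algebra)
  then have "(\<lambda>(x, \<rho>'). outcomes_from \<mu> L C T \<rho>' \<bind> (\<lambda>xs. return (count_space UNIV) (x # xs))) \<in>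
      algorithm_step \<mu> L C \<rho> \<rightarrow>\<^sub>M subprob_algebra (count_space UNIV)"
    using measurable_prob_algebraD[OF measurable_cons_outcome[OF measurable_outcomes_from]]
    by (simp cong: measurable_cong_sets)
  then show ?thesis
    unfolding outcomes_from.simps
    by (subst nn_integral_bind[where B = "count_space UNIV"]) (auto simp: split_beta' cons)
qed

lemma nn_integral_algorithm_step:
  fixes C :: "nat \<Rightarrow> 'q::finite clause"
  assumes f: "f \<in> borel_measurable step_space" and L: "1 \<le> L"
    and valid: "\<And>\<alpha>. \<alpha> \<in> {1..L} \<Longrightarrow> valid_clause (C \<alpha>)" and \<rho>: "density_matrix \<rho>"
  shows "(\<integral>\<^sup>+ z. f z \<partial>algorithm_step \<mu> L C \<rho>) =
    (\<Sum>\<alpha>\<in>{1..L}.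
      (\<Sum>i\<in>qubits (C \<alpha>). \<integral>\<^sup>+ U. f (True, rotate_qubit i U (post1 (C \<alpha>) \<rho>)) \<partial>\<mu>) / 2 *
        ennreal (outcome1_prob (C \<alpha>) \<rho>) +
      f (False, post0 (C \<alpha>) \<rho>) * ennreal (1 - outcome1_prob (C \<alpha>) \<rho>)) / ennreal (real L)"
proof -
  have bind_pmf: "(\<integral>\<^sup>+ z. f z \<partial>(measure_pmf p \<bind> K)) = (\<integral>\<^sup>+ a. (\<integral>\<^sup>+ z. f z \<partial>K a) \<partial>p)"
    if "\<And>a. K a \<in> space (prob_algebra step_space)" for p :: "'b pmf" and K
    using that
    by (intro nn_integral_bind[OF f]) (auto simp: space_prob_algebra space_subprob_algebra
        prob_space_imp_subprob_space)
  have rot: "(\<integral>\<^sup>+ z. f z \<partial>rotation_step \<Phi> \<rho> i) =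
      (\<integral>\<^sup>+ U. f (True, rotate_qubit i U (post1 \<Phi> \<rho>)) \<partial>\<mu>)" for \<Phi> i
    unfolding rotation_step_def
    by (subst nn_integral_bind[OF f measurable_prob_algebraD[OF measurable_rotation_kernel]])
      (auto simp: nn_integral_return space_pair_measure f)
  have rot_space: "rotation_step \<Phi> \<rho> i \<in> space (prob_algebra step_space)" for \<Phi> i
    using measurable_space[OF measurable_rotation_step] by simp
  have step_space: "clause_step \<Phi> \<rho> x \<in> space (prob_algebra step_space)" for \<Phi> x
    using measurable_space[OF measurable_clause_step] by simp
  have outcome_space: "measure_pmf (bernoulli_pmf (outcome1_prob \<Phi> \<rho>)) \<bind> clause_step \<Phi> \<rho>
      \<in> space (prob_algebra step_space)" for \<Phi>
    using measurable_space[OF measurable_outcome_step] by simp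
  have clause: "(\<integral>\<^sup>+ z. f z \<partial>(measure_pmf (bernoulli_pmf (outcome1_prob \<Phi> \<rho>)) \<bind> clause_step \<Phi> \<rho>)) =
      (\<Sum>i\<in>qubits \<Phi>. \<integral>\<^sup>+ U. f (True, rotate_qubit i U (post1 \<Phi> \<rho>)) \<partial>\<mu>) / 2 *
        ennreal (outcome1_prob \<Phi> \<rho>) +
      f (False, post0 \<Phi> \<rho>) * ennreal (1 - outcome1_prob \<Phi> \<rho>)" if \<Phi>: "valid_clause \<Phi>" for \<Phi>
  proof -
    \<comment> \<open>The two qubits are distinct, which gives the divisor 2 of the uniform
      choice.\<close>
    have q: "finite (qubits \<Phi>)" "qubits \<Phi> \<noteq> {}" "card (qubits \<Phi>) = 2"
      using \<Phi> by (cases \<Phi>; auto)+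
    have "(\<integral>\<^sup>+ z. f z \<partial>clause_step \<Phi> \<rho> True) =
        (\<Sum>i\<in>qubits \<Phi>. \<integral>\<^sup>+ U. f (True, rotate_qubit i U (post1 \<Phi> \<rho>)) \<partial>\<mu>) / 2"
      using q by (simp add: clause_step_def bind_pmf rot_space rot nn_integral_pmf_of_set)
    moreover have "(\<integral>\<^sup>+ z. f z \<partial>clause_step \<Phi> \<rho> False) = f (False, post0 \<Phi> \<rho>)"
      by (simp add: clause_step_def nn_integral_return space_pair_measure f)
    ultimately show ?thesis
      using outcome1_prob_bounds[OF \<Phi> \<rho>] by (subst bind_pmf) (simp_all add: step_space)
  qed
  show ?thesis
    unfolding algorithm_step_eq
    by (subst bind_pmf)
      (use L in \<open>auto simp: outcome_space nn_integral_pmf_of_set clause valid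
        ennreal_of_nat_eq_real_of_nat intro!: arg_cong2[of _ _ _ _ "(/)"] sum.cong\<close>)
qed

end

subsection \<open>Expected number of outcomes 1\<close>

locale haar_bases = haar \<mu> + qubit_bases e
  for \<mu> and e :: "'q::finite \<Rightarrow> bool \<Rightarrow> complex ^ bool"
begin

lemma positive_matrix_rotate_qubit: "positive_matrix \<rho> \<Longrightarrow> positive_matrix (rotate_qubit i U \<rho>)"
  unfolding rotate_qubit_def by (rule positive_matrix_conj)

lemma density_matrix_rotate_qubit:
  "density_matrix \<rho> \<Longrightarrow> unitary U \<Longrightarrow> density_matrix (rotate_qubit i U \<rho>)"
  unfolding rotate_qubit_def
  by (rule density_matrix_conj) (auto simp: on_qubit_mult unitary_def)

text \<open>It is the mean of the potentials of a positive operator and of its flip.\<close>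

lemma resampled_potential_nonneg:
  assumes "positive_matrix \<rho>"
  shows "0 \<le> resampled_potential e i \<rho>"
proof -
  have "positive_matrix (pauli_x e i ** \<rho> ** pauli_x e i)"
    using positive_matrix_conj[OF assms, of "pauli_x e i"] by (simp add: pauli_adjoint)
  then show ?thesis
    using potential_pauli_x_conj[of i \<rho>] potential_nonneg assms by (smt (verit))
qed

text \<open>
  Of the Haar property only invariance under the flip of the two basis vectors of qubit \<open>i\<close> is used: a
  state and its flip already average to the resampled potential.
\<close>

lemma nn_integral_potential_rotate:
  assumes \<rho>: "positive_matrix \<rho>"
  shows "(\<integral>\<^sup>+ U. ennreal (potential e (rotate_qubit i U \<rho>)) \<partial>\<mu>) = ennreal (resampled_potential e i \<rho>)"
proof -
  interpret prob_space \<mu> by (rule prob_space_haar)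
  define h where "h U = ennreal (potential e (rotate_qubit i U \<rho>))" for U
  define V where "V = in_basis (e i) sigma_x"
  have h [measurable]: "h \<in> borel_measurable borel"
    unfolding h_def potential_def rotate_qubit_def
    by (intro measurable_compose[OF _ measurable_ennreal] borel_measurable_continuous_onI
        continuous_intros matrix_continuous_intros) auto
  have V [measurable]: "(\<lambda>U. V ** U) \<in> borel \<rightarrow>\<^sub>M borel"
    by (intro borel_measurable_continuous_onI matrix_continuous_intros)
  have "unitary V" unfolding V_def by (rule unitary_in_basis_sigma_x[OF orthonormal])
  then have "(\<integral>\<^sup>+ U. h U \<partial>\<mu>) = (\<integral>\<^sup>+ U. h U \<partial>distr \<mu> borel (\<lambda>U. V ** U))"
    by (simp add: haar_invariant)
  also have "\<dots> = (\<integral>\<^sup>+ U. h (V ** U) \<partial>\<mu>)"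
    by (rule nn_integral_distr) measurable
  finally have inv: "(\<integral>\<^sup>+ U. h U \<partial>\<mu>) = (\<integral>\<^sup>+ U. h (V ** U) \<partial>\<mu>)" .
  \<comment> \<open>Doubling pairs \<open>U\<close> with \<open>V ** U\<close>, and the pair has a
    constant sum.\<close>
  have "2 * (\<integral>\<^sup>+ U. h U \<partial>\<mu>) = (\<integral>\<^sup>+ U. h (V ** U) \<partial>\<mu>) + (\<integral>\<^sup>+ U. h U \<partial>\<mu>)"
    by (simp add: mult_2 flip: inv)
  also have "\<dots> = (\<integral>\<^sup>+ U. h (V ** U) + h U \<partial>\<mu>)"
    by (rule nn_integral_add[symmetric]) measurable
  also have "\<dots> = (\<integral>\<^sup>+ U. 2 * ennreal (resampled_potential e i \<rho>) \<partial>\<mu>)"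
  proof (rule nn_integral_cong_AE, use AE_unitary in eventually_elim)
    fix U :: "complex ^ bool ^ bool" assume "unitary U"
    from potential_rotate_average[OF this, of i \<rho>]
    have "h (V ** U) + h U = ennreal (2 * resampled_potential e i \<rho>)"
      by (simp add: h_def V_def potential_nonneg positive_matrix_rotate_qubit \<rho> flip: ennreal_plus)
    then show "h (V ** U) + h U = 2 * ennreal (resampled_potential e i \<rho>)"
      by (simp add: ennreal_mult')
  qed
  also have "\<dots> = 2 * ennreal (resampled_potential e i \<rho>)" by (simp add: emeasure_space_1)
  finally show ?thesis by (simp add: h_def ennreal_mult_cancel_left)
qed

text \<open>
  Counting the outcomes 1 as \<open>T - count_list xs False\<close> avoids a separate proof that almost every outcome
  list has length \<open>T\<close>.
\<close>

lemma nn_integral_nonzero_outcomes_le: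
  fixes C :: "nat \<Rightarrow> 'q clause"
  assumes L: "1 \<le> L" and valid: "\<And>\<alpha>. \<alpha> \<in> {1..L} \<Longrightarrow> valid_clause (C \<alpha>)"
    and restricted: "\<And>\<alpha>. \<alpha> \<in> {1..L} \<Longrightarrow> restricted_clause e (C \<alpha>)"
    and \<rho>: "density_matrix \<rho>"
  shows "(\<integral>\<^sup>+ xs. of_nat (T - count_list xs False) \<partial>outcomes_from \<mu> L C T \<rho>) \<le> ennreal (potential e \<rho>)"
  using \<rho>
proof (induction T arbitrary: \<rho>)
  case 0
  then show ?case by simp
next
  case (Suc T)
  interpret \<mu>: prob_space \<mu> by (rule prob_space_haar)
  define E where "E \<sigma> = (\<integral>\<^sup>+ xs. of_nat (T - count_list xs False) \<partial>outcomes_from \<mu> L C T \<sigma>)" for \<sigma>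
  \<comment> \<open>The expected count given the first outcome and the state after it.\<close>
  define F where "F z = (\<integral>\<^sup>+ xs. of_nat (Suc T - count_list (fst z # xs) False)
    \<partial>outcomes_from \<mu> L C T (snd z))" for z
  have F [measurable]: "F \<in> borel_measurable step_space"
    unfolding F_def
    by (rule measurable_pair_measure_countable1) (auto simp: measurable_nn_integral_outcomes_from)
  have F_False: "F (False, \<sigma>) = E \<sigma>" for \<sigma>
    by (simp add: F_def E_def)
  have F_True: "F (True, \<sigma>) \<le> 1 + E \<sigma>" for \<sigma>
  proof -
    interpret prob_space "outcomes_from \<mu> L C T \<sigma>" by (rule prob_space_outcomes_from)
    have "F (True, \<sigma>) \<le> (\<integral>\<^sup>+ xs. 1 + of_nat (T - count_list xs False) \<partial>outcomes_from \<mu> L C T \<sigma>)"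
      unfolding F_def fst_conv snd_conv
    proof (intro nn_integral_mono)
      fix xs :: "bool list"
      \<comment> \<open>Only an inequality, because natural subtraction truncates: it is strict for
        lists with more than \<open>T\<close> zeros.\<close>
      have "Suc T - count_list ((True :: bool) # xs) False \<le> 1 + (T - count_list xs False)" by simp
      then have "(of_nat (Suc T - count_list ((True :: bool) # xs) False) :: ennreal) \<le>
        of_nat (1 + (T - count_list xs False))" by (rule of_nat_mono)
      then show "of_nat (Suc T - count_list (True # xs) False) \<le>
          1 + (of_nat (T - count_list xs False) :: ennreal)"
        by simp
    qed
    also have "\<dots> = 1 + E \<sigma>"
      unfolding E_def by (subst nn_integral_add)
        (auto simp: emeasure_space_1 measurable_def sets_outcomes_from)
    finally show ?thesis .
  qed
  have rotated: "(\<integral>\<^sup>+ U. F (True, rotate_qubit i U \<sigma>) \<partial>\<mu>) \<le> ennreal (1 + resampled_potential e i \<sigma>)"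
    if \<sigma>: "density_matrix \<sigma>" for i \<sigma>
  proof -
    have pos: "positive_matrix \<sigma>" using \<sigma> by (simp add: density_matrix_def)
    have "(\<integral>\<^sup>+ U. F (True, rotate_qubit i U \<sigma>) \<partial>\<mu>) \<le>
        (\<integral>\<^sup>+ U. 1 + ennreal (potential e (rotate_qubit i U \<sigma>)) \<partial>\<mu>)"
    \<comment> \<open>The induction hypothesis speaks of states only, and the rotated operator is
      known to be one only for unitary \<open>U\<close>, hence almost everywhere.\<close>
    proof (rule nn_integral_mono_AE, use AE_unitary in eventually_elim)
      fix U :: "complex ^ bool ^ bool" assume "unitary U"
      then have "E (rotate_qubit i U \<sigma>) \<le> ennreal (potential e (rotate_qubit i U \<sigma>))"
        unfolding E_def by (intro Suc.IH density_matrix_rotate_qubit \<sigma>)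
      then show "F (True, rotate_qubit i U \<sigma>) \<le> 1 + ennreal (potential e (rotate_qubit i U \<sigma>))"
        using F_True order_trans add_left_mono by blast
    qed
    also have "\<dots> = 1 + (\<integral>\<^sup>+ U. ennreal (potential e (rotate_qubit i U \<sigma>)) \<partial>\<mu>)"
    proof (subst nn_integral_add)
      have "(\<lambda>U. potential e (rotate_qubit i U \<sigma>)) \<in> borel_measurable borel"
        unfolding potential_def rotate_qubit_def
        by (intro borel_measurable_continuous_onI continuous_intros matrix_continuous_intros) auto
      then show "(\<lambda>U. ennreal (potential e (rotate_qubit i U \<sigma>))) \<in> borel_measurable \<mu>" by measurable
    qed (auto simp: \<mu>.emeasure_space_1)
    also have "\<dots> = ennreal (1 + resampled_potential e i \<sigma>)"
      by (simp add: nn_integral_potential_rotate pos resampled_potential_nonneg ennreal_plus)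
    finally show ?thesis .
  qed
  have clause: "(\<Sum>i\<in>qubits \<Phi>. \<integral>\<^sup>+ U. F (True, rotate_qubit i U (post1 \<Phi> \<rho>)) \<partial>\<mu>) / 2 *
      ennreal (outcome1_prob \<Phi> \<rho>) + F (False, post0 \<Phi> \<rho>) * ennreal (1 - outcome1_prob \<Phi> \<rho>)
      \<le> ennreal (potential e \<rho>)" (is "?A * ennreal ?p + ?B * _ \<le> _")
    if \<Phi>: "valid_clause \<Phi>" "restricted_clause e \<Phi>" for \<Phi>
  proof -
    obtain i j \<phi> where ij: "\<Phi> = (i, j, \<phi>)" by (cases \<Phi>) auto
    have neq: "i \<noteq> j" using \<Phi> by (simp add: ij)
    note p = outcome1_prob_bounds[OF \<Phi>(1) Suc.prems]
    let ?r = "\<lambda>k. resampled_potential e k (post1 \<Phi> \<rho>)"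
    have A: "?A * ennreal ?p \<le> ennreal (?p * (1 + (?r i + ?r j) / 2))"
    proof (cases "?p = 0")
      case False
      then have d: "density_matrix (post1 \<Phi> \<rho>)" by (rule density_matrix_post1[OF \<Phi>(1) Suc.prems])
      then have r: "0 \<le> ?r i" "0 \<le> ?r j"
        by (auto simp: density_matrix_def intro!: resampled_potential_nonneg)
      have "(\<Sum>i\<in>qubits \<Phi>. \<integral>\<^sup>+ U. F (True, rotate_qubit i U (post1 \<Phi> \<rho>)) \<partial>\<mu>)
          \<le> ennreal (1 + ?r i) + ennreal (1 + ?r j)"
        using neq rotated[OF d] by (simp add: ij add_mono)
      also have "\<dots> = ennreal (2 + ?r i + ?r j)" using r by (simp flip: ennreal_plus)
      finally have "?A \<le> ennreal (2 + ?r i + ?r j) / ennreal 2"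
        by (simp add: divide_right_mono_ennreal)
      also have "\<dots> = ennreal ((2 + ?r i + ?r j) / 2)" using r by (intro divide_ennreal) auto
      finally have "?A * ennreal ?p \<le> ennreal ((2 + ?r i + ?r j) / 2) * ennreal ?p"
        by (rule mult_right_mono) simp
      also have "\<dots> = ennreal (?p * (1 + (?r i + ?r j) / 2))"
        using r p by (simp add: field_simps flip: ennreal_mult)
      finally show ?thesis .
    qed simp
    have B: "?B * ennreal (1 - ?p) \<le> ennreal ((1 - ?p) * potential e (post0 \<Phi> \<rho>))"
      and B0: "0 \<le> (1 - ?p) * potential e (post0 \<Phi> \<rho>)"
    proof -
      have "?B * ennreal (1 - ?p) \<le> ennreal ((1 - ?p) * potential e (post0 \<Phi> \<rho>)) \<and>
          0 \<le> (1 - ?p) * potential e (post0 \<Phi> \<rho>)"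
      proof (cases "?p = 1")
        case False
        then have d: "density_matrix (post0 \<Phi> \<rho>)" by (rule density_matrix_post0[OF \<Phi>(1) Suc.prems])
        then have "0 \<le> potential e (post0 \<Phi> \<rho>)"
          by (auto simp: density_matrix_def intro!: potential_nonneg)
        moreover have "?B \<le> ennreal (potential e (post0 \<Phi> \<rho>))"
          unfolding F_False E_def by (rule Suc.IH[OF d])
        ultimately show ?thesis using p
          by (simp add: ennreal_mult mult.commute[of "ennreal (1 - ?p)"] mult_right_mono)
      qed simp
      then show "?B * ennreal (1 - ?p) \<le> ennreal ((1 - ?p) * potential e (post0 \<Phi> \<rho>))"
        and "0 \<le> (1 - ?p) * potential e (post0 \<Phi> \<rho>)" by auto
    qed
    have A0: "0 \<le> ?p * (1 + (?r i + ?r j) / 2)"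
    proof (cases "?p = 0")
      case False
      then have "density_matrix (post1 \<Phi> \<rho>)" by (rule density_matrix_post1[OF \<Phi>(1) Suc.prems])
      then have "0 \<le> ?r i" "0 \<le> ?r j"
        by (auto simp: density_matrix_def intro!: resampled_potential_nonneg)
      then show ?thesis using p by simp
    qed simp
    have "?A * ennreal ?p + ?B * ennreal (1 - ?p) \<le>
        ennreal (?p * (1 + (?r i + ?r j) / 2) + (1 - ?p) * potential e (post0 \<Phi> \<rho>))"
      using add_mono[OF A B] A0 B0 by (simp add: ennreal_plus)
    also have "\<dots> \<le> ennreal (potential e \<rho>)"
      by (intro ennreal_leI potential_step[OF \<Phi>(1) Suc.prems \<Phi>(2) ij])
    finally show ?thesis .
  qed
  have "(\<integral>\<^sup>+ xs. of_nat (Suc T - count_list xs False) \<partial>outcomes_from \<mu> L C (Suc T) \<rho>) =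
      (\<integral>\<^sup>+ z. F z \<partial>algorithm_step \<mu> L C \<rho>)"
    unfolding F_def by (rule nn_integral_outcomes_from_Suc)
  also have "\<dots> \<le> (\<Sum>\<alpha>\<in>{1..L}. ennreal (potential e \<rho>)) / ennreal (real L)"
    by (subst nn_integral_algorithm_step[OF F L valid Suc.prems], assumption)
      (intro divide_right_mono_ennreal sum_mono clause valid restricted)
  also have "\<dots> = ennreal (potential e \<rho>)"
    using L by (simp add: ennreal_of_nat_eq_real_of_nat ennreal_mult_divide_eq
        mult.commute[of "ennreal (real L)"])
  finally show ?case .
qed

text \<open>The squared magnetization has nonnegative expectation and is simply dropped; the exact
  value would be \<open>(n^2 - n) / 2\<close>.\<close>

lemma potential_maximally_mixed_le: "potential e maximally_mixed \<le> (real CARD('q))\<^sup>2 / 2"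
proof -
  have "positive_matrix (maximally_mixed :: 'q operator)" "re_trace (maximally_mixed :: 'q operator) = 1"
    using density_matrix_maximally_mixed by (auto simp: density_matrix_def)
  then show ?thesis
    using positive_matrix_re_trace_mult[of maximally_mixed "magnetization e"]
    by (simp add: potential_def magnetization_adjoint)
qed

end

subsection \<open>A single clause\<close>

text \<open>Flips of bits \<open>i\<close> and \<open>j\<close> permute the bit strings, so four
  flipped copies of the diagonal sum are equal. Together they run, for every string, through all
  four squared coefficients of the clause vector, whose total is 1.\<close>

lemma outcome1_prob_maximally_mixed:
  fixes \<Phi> :: "'q::finite clause"
  assumes "valid_clause \<Phi>"
  shows "outcome1_prob \<Phi> maximally_mixed = 1 / 4"
proof -
  obtain i j \<phi> where \<Phi>: "\<Phi> = (i, j, \<phi>)" by (cases \<Phi>) auto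
  have ij: "i \<noteq> j" and n: "norm \<phi> = 1" using assms by (auto simp: \<Phi>)
  define g where "g p = (cmod (\<phi> $ p))\<^sup>2" for p
  have flip: "(\<Sum>x\<in>UNIV. G (x(k := \<not> x k))) = (\<Sum>x\<in>UNIV. G x)" for G :: "('q \<Rightarrow> bool) \<Rightarrow> real" and k
    by (rule sum.reindex_bij_witness[of _ "\<lambda>x. x(k := \<not> x k)" "\<lambda>x. x(k := \<not> x k)"]) auto
  have i: "(\<Sum>x\<in>UNIV. h (\<not> x i) (x j)) = (\<Sum>x\<in>UNIV. h (x i) (x j))"
    and j: "(\<Sum>x\<in>UNIV. h (x i) (\<not> x j)) = (\<Sum>x\<in>UNIV. h (x i) (x j))" for h :: "bool \<Rightarrow> bool \<Rightarrow> real"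
    using flip[of "\<lambda>x. h (x i) (x j)" i] flip[of "\<lambda>x. h (x i) (x j)" j] ij by auto
  have "4 * (\<Sum>x\<in>UNIV. g (x i, x j)) =
      (\<Sum>x\<in>UNIV. g (x i, x j) + g (\<not> x i, x j) + g (x i, \<not> x j) + g (\<not> x i, \<not> x j))"
    using i[of "\<lambda>s t. g (s, t)"] j[of "\<lambda>s t. g (s, t)"] j[of "\<lambda>s t. g (\<not> s, t)"]
    by (simp add: sum.distrib)
  also have "\<dots> = (\<Sum>x\<in>(UNIV :: ('q \<Rightarrow> bool) set). \<Sum>p\<in>UNIV. g p)"
  proof (rule sum.cong[OF refl])
    fix x :: "'q \<Rightarrow> bool"
    have "(\<Sum>p\<in>UNIV. g p) = g (False, False) + g (False, True) + g (True, False) + g (True, True)"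
      by (simp add: UNIV_Times_UNIV[symmetric] UNIV_bool sum.cartesian_product[symmetric] del: UNIV_Times_UNIV)
    then show "g (x i, x j) + g (\<not> x i, x j) + g (x i, \<not> x j) + g (\<not> x i, \<not> x j) = (\<Sum>p\<in>UNIV. g p)"
      by (cases "x i"; cases "x j") auto
  qed
  also have "(\<Sum>p\<in>UNIV. g p) = 1"
    using n by (simp add: g_def norm_vec_def L2_set_def)
  finally have "(\<Sum>x\<in>UNIV. g (x i, x j)) = 2 ^ CARD('q) / 4" by (simp add: card_fun)
  moreover have "re_trace (projector \<Phi>) = (\<Sum>x\<in>UNIV. g (x i, x j))"
    by (simp add: \<Phi> trace_def g_def complex_norm_square[symmetric] del: of_real_power)
  ultimately show ?thesis
    by (simp add: outcome1_prob_def maximally_mixed_def matrix_distribs re_trace_simps field_simps)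
qed

context haar
begin

text \<open>Only the first measurement can go wrong. Outcome 1 is charged its full probability,
  whatever follows; after outcome 0 the clause has probability 0, and the induction hypothesis then
  bounds the rest by 0.\<close>

lemma nn_integral_single_clause_le:
  fixes C :: "nat \<Rightarrow> 'q::finite clause"
  assumes valid: "valid_clause (C 1)" and \<rho>: "density_matrix \<rho>"
  shows "(\<integral>\<^sup>+ xs. of_bool (count_list xs False < T) \<partial>outcomes_from \<mu> 1 C T \<rho>)
    \<le> ennreal (outcome1_prob (C 1) \<rho>)"
  using \<rho>
proof (induction T arbitrary: \<rho>)
  case 0
  then show ?case by simp
next
  case (Suc T)
  interpret \<mu>: prob_space \<mu> by (rule prob_space_haar)
  define F where "F z = (\<integral>\<^sup>+ xs. of_bool (count_list (fst z # xs) False < Suc T)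
    \<partial>outcomes_from \<mu> 1 C T (snd z))" for z
  have F [measurable]: "F \<in> borel_measurable step_space"
    unfolding F_def
    by (rule measurable_pair_measure_countable1) (auto simp: measurable_nn_integral_outcomes_from)
  have F_True: "F (True, \<sigma>) \<le> 1" for \<sigma>
  proof -
    interpret prob_space "outcomes_from \<mu> 1 C T \<sigma>" by (rule prob_space_outcomes_from)
    have "F (True, \<sigma>) \<le> (\<integral>\<^sup>+ xs. 1 \<partial>outcomes_from \<mu> 1 C T \<sigma>)"
      unfolding F_def fst_conv snd_conv by (intro nn_integral_mono) auto
    also have "\<dots> = 1" by (subst nn_integral_const) (simp only: emeasure_space_1 mult_1)
    finally show ?thesis .
  qed
  let ?\<Phi> = "C 1" and ?p = "outcome1_prob (C 1) \<rho>"
  note p = outcome1_prob_bounds[OF valid Suc.prems]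
  have card: "card (qubits ?\<Phi>) = 2" using valid by (cases ?\<Phi>) auto
  have "(\<Sum>i\<in>qubits ?\<Phi>. \<integral>\<^sup>+ U. F (True, rotate_qubit i U (post1 ?\<Phi> \<rho>)) \<partial>\<mu>)
      \<le> (\<Sum>i\<in>qubits ?\<Phi>. \<integral>\<^sup>+ U. 1 \<partial>\<mu>)"
    by (intro sum_mono nn_integral_mono F_True)
  then have "(\<Sum>i\<in>qubits ?\<Phi>. \<integral>\<^sup>+ U. F (True, rotate_qubit i U (post1 ?\<Phi> \<rho>)) \<partial>\<mu>) / 2 \<le> 2 / 2"
    by (intro divide_right_mono_ennreal) (simp add: \<mu>.emeasure_space_1 card del: One_nat_def)
  then have A: "(\<Sum>i\<in>qubits ?\<Phi>. \<integral>\<^sup>+ U. F (True, rotate_qubit i U (post1 ?\<Phi> \<rho>)) \<partial>\<mu>) / 2 \<le> 1"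
    by simp
  have B: "F (False, post0 ?\<Phi> \<rho>) * ennreal (1 - ?p) = 0"
  proof (cases "?p = 1")
    case False
    then have "density_matrix (post0 ?\<Phi> \<rho>)" by (rule density_matrix_post0[OF valid Suc.prems])
    from Suc.IH[OF this] have "F (False, post0 ?\<Phi> \<rho>) \<le> 0"
      by (simp add: F_def outcome1_prob_post0[OF valid Suc.prems] del: One_nat_def)
    then show ?thesis by simp
  qed simp
  have "(\<integral>\<^sup>+ xs. of_bool (count_list xs False < Suc T) \<partial>outcomes_from \<mu> 1 C (Suc T) \<rho>) =
      (\<integral>\<^sup>+ z. F z \<partial>algorithm_step \<mu> 1 C \<rho>)"
    unfolding F_def by (rule nn_integral_outcomes_from_Suc)
  also have "\<dots> = (\<Sum>i\<in>qubits ?\<Phi>. \<integral>\<^sup>+ U. F (True, rotate_qubit i U (post1 ?\<Phi> \<rho>)) \<partial>\<mu>) / 2 * ennreal ?p"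
    by (subst nn_integral_algorithm_step[OF F order_refl _ Suc.prems])
      (use valid in \<open>auto simp: B divide_ennreal_def[of _ 1] simp del: One_nat_def\<close>)
  also have "\<dots> \<le> 1 * ennreal ?p" by (rule mult_right_mono[OF A]) simp
  finally show ?case by simp
qed

end

section \<open>The threshold and the final estimate\<close>

text \<open>Here \<open>y\<close> stands for \<open>f L\<close>. Since
  \<open>y^2 (1 - (1 - 1/y)^3) = 3 y - 3 + 1/y\<close>, and this is at least 3 for \<open>y\<close>
  at least 2, the cubic factor alone yields three times \<open>n^2 / 2\<close>.\<close>

lemma outcome_threshold_bound:
  fixes y n T :: real
  assumes y: "2 \<le> y" and n: "0 \<le> n" and T: "T = y\<^sup>2 * n\<^sup>2 / 2"
  shows "3 / 2 * n\<^sup>2 \<le> T - (T * ((y - 1) / y) ^ 3 - y * n)"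
proof -
  have "T - T * ((y - 1) / y) ^ 3 = n\<^sup>2 / 2 * (3 * y - 3 + 1 / y)"
    using y unfolding T by (simp add: field_simps power2_eq_square power3_eq_cube)
  moreover have "n\<^sup>2 / 2 * 3 \<le> n\<^sup>2 / 2 * (3 * y - 3 + 1 / y)"
  proof (rule mult_left_mono)
    have "0 \<le> 1 / y" using y by simp
    then show "3 \<le> 3 * y - 3 + 1 / y" using y by linarith
  qed simp
  moreover have "0 \<le> y * n" using y n by simp
  ultimately show ?thesis by linarith
qed

theorem mainTheorem1:
  fixes C :: "nat \<Rightarrow> 'q::finite clause"
    and \<mu> :: "(complex ^ bool ^ bool) measure"
    and n L T :: nat
    and c f N :: real
  assumes "n = CARD('q)" and "n \<ge> 2" and "L \<ge> 1" and "c > 0"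
    and "restricted_yes_instance L C"
    and "haar_measure_U2 \<mu>"
    and "f = max (7 / c) 1"
    and "real T = f\<^sup>2 * (real L)\<^sup>2 * (real n)\<^sup>2 / 2"
    and "N = real T * ((f * real L - 1) / (f * real L)) ^ 3 - f * real L * real n"
  shows "measure (algorithm_outcomes \<mu> L C T) {xs. real (count_list xs False) \<ge> N} \<ge> 2 / 3"
proof -
  obtain e where e: "\<And>i. orthonormal_basis (e i)"
    and restricted: "\<And>\<alpha>. \<alpha> \<in> {1..L} \<Longrightarrow> restricted_clause e (C \<alpha>)"
    and valid: "\<And>\<alpha>. \<alpha> \<in> {1..L} \<Longrightarrow> valid_clause (C \<alpha>)"
    using assms(5) unfolding restricted_yes_instance_def by blast
  interpret haar_bases \<mu> e by unfold_locales (fact assms(6), fact e)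
  define M where "M = outcomes_from \<mu> L C T maximally_mixed"
  interpret M: prob_space M unfolding M_def by (rule prob_space_outcomes_from)
  have sets_M: "sets M = UNIV" unfolding M_def by (rule sets_outcomes_from)
  then have space_M: "space M = UNIV" by (metis UNIV_I sets.sets_into_space top.extremum_uniqueI)
  let ?few = "{xs. real (count_list xs False) < N}"
  have f: "1 \<le> f" using assms(7) by simp
  then have fL: "1 \<le> f * real L" using assms(3) mult_mono[of 1 f 1 "real L"] by simp
  have few: "M.prob ?few \<le> 1 / 3"
  \<comment> \<open>For two or more clauses \<open>f \<ge> 1\<close> gives
    \<open>f L \<ge> 2\<close>, the range of the threshold bound. A single clause fails with
    probability at most 1/4, below the 1/3 allowed.\<close>
  proof (cases "L = 1")
    case True
    have frac: "((f * real L - 1) / (f * real L)) ^ 3 \<le> 1"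
      using fL by (intro power_le_one) auto
    have "N \<le> real T"
      using mult_left_mono[OF frac, of "real T"] fL assms(9) mult_nonneg_nonneg[of "f * real L" "real n"]
      by linarith
    then have mono: "M.prob ?few \<le> M.prob {xs. count_list xs False < T}"
      by (intro M.finite_measure_mono) (auto simp: sets_M)
    have "ennreal (M.prob {xs. count_list xs False < T}) =
        (\<integral>\<^sup>+ xs. of_bool (count_list xs False < T) \<partial>M)"
    proof -
      have "(\<integral>\<^sup>+ xs. of_bool (count_list xs False < T) \<partial>M) =
          (\<integral>\<^sup>+ xs. indicator {xs. count_list xs False < T} xs \<partial>M)"
        by (intro nn_integral_cong) (auto simp: indicator_def)
      then show ?thesis by (simp add: sets_M M.emeasure_eq_measure)
    qed
    also have "\<dots> \<le> ennreal (outcome1_prob (C 1) maximally_mixed)"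
      unfolding M_def True
      by (rule nn_integral_single_clause_le[OF _ density_matrix_maximally_mixed])
        (use valid True in auto)
    finally have "M.prob {xs. count_list xs False < T} \<le> outcome1_prob (C 1) maximally_mixed"
      using valid True by (simp add: outcome1_prob_maximally_mixed ennreal_le_iff)
    with mono show ?thesis using valid True
      by (simp add: outcome1_prob_maximally_mixed)
  next
    case False
    define K where "K = real T - N"
    have "2 \<le> f * real L" using f False assms(3) mult_mono[of 1 f 2 "real L"] by simp
    moreover have "real T = (f * real L)\<^sup>2 * (real n)\<^sup>2 / 2"
      using assms(8) by (simp only: power_mult_distrib)
    ultimately have K: "3 / 2 * (real n)\<^sup>2 \<le> K"
      unfolding K_def assms(9) by (intro outcome_threshold_bound) auto
    have n: "0 < (real n)\<^sup>2" using assms(2) by simp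
    then have K0: "0 < K" using K by linarith
    \<comment> \<open>Markov's inequality, written out: with fewer than \<open>N\<close> zeros the
      counter \<open>T - count_list xs False\<close> is at least \<open>K\<close>.\<close>
    have "ennreal K * emeasure M ?few = (\<integral>\<^sup>+ xs. ennreal K * indicator ?few xs \<partial>M)"
      by (simp add: nn_integral_cmult_indicator sets_M)
    also have "\<dots> \<le> (\<integral>\<^sup>+ xs. of_nat (T - count_list xs False) \<partial>M)"
    proof (rule nn_integral_mono)
      fix xs :: "bool list"
      have "K \<le> real (T - count_list xs False)" if "real (count_list xs False) < N"
        using that by (auto simp: K_def of_nat_diff_if)
      then show "ennreal K * indicator ?few xs \<le> of_nat (T - count_list xs False)"
        by (auto simp: indicator_def ennreal_of_nat_eq_real_of_nat ennreal_leI)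
    qed
    also have "\<dots> \<le> ennreal (potential e maximally_mixed)"
      unfolding M_def
      by (rule nn_integral_nonzero_outcomes_le[OF assms(3) valid restricted density_matrix_maximally_mixed])
    also have "\<dots> \<le> ennreal ((real n)\<^sup>2 / 2)"
      using potential_maximally_mixed_le assms(1) by (intro ennreal_leI) simp
    finally have "ennreal (K * M.prob ?few) \<le> ennreal ((real n)\<^sup>2 / 2)"
      using K0 by (simp add: M.emeasure_eq_measure ennreal_mult)
    then have "K * M.prob ?few \<le> (real n)\<^sup>2 / 2" by (simp add: ennreal_le_iff)
    moreover have "3 / 2 * (real n)\<^sup>2 * M.prob ?few \<le> K * M.prob ?few"
      by (intro mult_right_mono K) simp
    ultimately have "(real n)\<^sup>2 * (3 * M.prob ?few) \<le> (real n)\<^sup>2 * 1" by linarith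
    then have "3 * M.prob ?few \<le> 1" using n by (simp only: mult_le_cancel_left_pos)
    then show ?thesis by simp
  qed
  have "{xs. real (count_list xs False) \<ge> N} = space M - ?few" by (auto simp: space_M)
  then have "M.prob {xs. real (count_list xs False) \<ge> N} = 1 - M.prob ?few"
    by (simp add: M.prob_compl sets_M)
  then show ?thesis using few by (simp add: M_def algorithm_outcomes_def)
qed

end
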